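(* Consider the quantum principal $\mathcal U(1)$-bundle $\zeta=(\mathbb T^{n+1}_\Xi,\mathbb T^n_\Xi,\Delta_P)$ over the quantum $n$-torus ($n\ge2$) with the differential calculus described in the context, where $U(1)$ carries its classical differential calculus. Let $\omega$ be a quantum principal connection different from $\omega^c$, and write $\omega=\omega^c+\lambda$ with $\lambda(\vartheta)=\mu\in\Omega^1(\mathbb T^n_\Xi)$, $\mu^*=\mu$ (so $R^\omega(\vartheta)=d\mu$). Then $\omega$ is a Yang–Mills quantum principal connection if and only if $$d^{\star_q}d\mu=0 .$$
   Context: **Quantum tori.** Fix $n\ge2$ and a real antisymmetric $(n+1)\times(n+1)$ matrix $\Xi$. For $m\in\{n,n+1\}$, $\mathbb T^m_\Xi$ is the $*$-algebra of formal sums $\sum a_{k_1\cdots k_m}u_1^{k_1}\cdots u_m^{k_m}$ with rapidly decaying coefficients, with $u_k^*=u_k^{-1}$, $u_ku_j=e^{2\pi i\Xi_{kj}}u_ju_k$ ($k,j\le m$); $\mathbb T^n_\Xi\subset\mathbb T^{n+1}_\Xi$. $\delta_j$ is the derivation with $\delta_j(u_k)=2\pi i\,u_j$ if $k=j$ and $0$ otherwise. $\Omega^\bullet(\mathbb T^m_\Xi)=\mathbb T^m_\Xi\otimes\bigwedge^\bullet\mathbb C^m$ with $(x_1\otimes v_1)(x_2\otimes v_2)=x_1x_2\otimes v_1\wedge v_2$, $(x\otimes v)^*=x^*\otimes v^*$ ($v^*$ complex conjugation in the canonical basis $\bar e_j$), $d\mathbb U_j:=\mathbf 1\otimes\bar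 e_j$, $dx=i\sum_j\delta_j(x)\,d\mathbb U_j$, $d(x\,d\mathbb U_{j_1}\cdots d\mathbb U_{j_k})=dx\,d\mathbb U_{j_1}\cdots d\mathbb U_{j_k}$. Then $d(a^* )=-(da)^*$. Volume form $\mathrm{dvol}=d\mathbb U_1\cdots d\mathbb U_n$; Hodge operator $\star_q:\Omega^k(\mathbb T^n_\Xi)\to\Omega^{n-k}(\mathbb T^n_\Xi)$, $x\otimes v\mapsto x\otimes\star v$, with $\star$ the Hodge operator of $\bigwedge^\bullet\mathbb C^n$. For $\nu\in\Omega^{a+1}(\mathbb T^n_\Xi)$, $d^{\star_q}\nu:=(-1)^a\star_q^{-1}d\star_q\nu$ (formal adjoint of $d$). **Bundle.** $G=\mathbb C[z,z^{-1}]$, $z^*=z^{-1}$, $\Delta(z^k)=z^k\otimes z^k$, $\epsilon(z^k)=1$, $S(z^k)=z^{k*}$. Classical calculus of $U(1)$: $\vartheta:=\pi(z)=z^*dz$, $\mathfrak u(1)^\#_{\mathbb C}=\mathbb C\vartheta$, $\Gamma^\wedge=G\oplus G\vartheta$, $\vartheta$ commutes with $G$, $\vartheta^2=0$, $d\vartheta=0$, $\vartheta^*=\vartheta$, $\pi(z^k)=k\vartheta$, $\mathrm{ad}(\vartheta)=\vartheta\otimes\mathbf 1$. $P=\mathbb T^{n+1}_\Xi$, $\Delta_P(u_i)=u_i\otimes\mathbf 1$ ($i\le n$), $\Delta_P(u_{n+1})=u_{n+1}\otimes z$; $\Omega^\bullet(P)=\Omega^\bullet(\mathbb T^{n+1}_\Xi)$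 with $\Delta_{\Omega^\bullet(P)}:\Omega^\bullet(P)\to\Omega^\bullet(P)\otimes\Gamma^\wedge$ the graded differential $*$-algebra morphism extending $\Delta_P$. Horizontal forms $\mathrm{Hor}^\bullet P=P\,\Omega^\bullet(\mathbb T^n_\Xi)$; base forms $\Omega^\bullet(\mathbb T^n_\Xi)$. **Connections.** A quantum principal connection is a linear map $\omega:\mathfrak u(1)^\#_{\mathbb C}\to\Omega^1(P)$ with $\Delta_{\Omega^\bullet(P)}(\omega(\theta))=(\omega\otimes\mathrm{id})\mathrm{ad}(\theta)+\mathbf 1\otimes\theta$ and $\omega(\theta^* )=\omega(\theta)^*$. One is $\omega^c(\vartheta)=u_{n+1}^*du_{n+1}$, and every one is $\omega^c+\lambda$ with $\lambda(\vartheta)=\mu\in\Omega^1(\mathbb T^n_\Xi)$, $\mu=\mu^*$. With the embedded differential $\Theta=0$ the curvature is $R^\omega=d\omega$, $R^\omega(\vartheta)=d\mu$. **Yang–Mills equation.** $E=\mathrm{Mor}(\mathrm{ad},\Delta_P)$ (linear $T:\mathbb C\vartheta\to P$ with $T(\vartheta)\in\mathbb T^n_\Xi$) as a right $\mathbb T^n_\Xi$-module. $\mathrm{Mor}(\mathrm{ad},\Delta_{\mathrm{Hor}})$ consists of linear $\tau:\mathbb C\vartheta\to\mathrm{Hor}^\bullet P$ with $\tau(\vartheta)\in\Omega^\bullet(\mathbb T^n_\Xi)$; $\widehat\Upsilon:\mathrm{Mor}(\mathrm{ad},\Delta_{\mathrm{Hor}})\to E\otimes_{\mathbb T^n_\Xi}\Omega^\bullet(\mathbb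 T^n_\Xi)$ is the isomorphism with inverse $T\otimes\mu\mapsto T\mu$. The dual covariant derivative is $\widehat D^\omega(\varphi)=d\varphi+\omega(\pi(S^{-1}(\varphi^{(1)})))\varphi^{(0)}$ for horizontal $\varphi$ with $\Delta_{\Omega^\bullet(P)}(\varphi)=\varphi^{(0)}\otimes\varphi^{(1)}$, acting on $\tau\in\mathrm{Mor}(\mathrm{ad},\Delta_{\mathrm{Hor}})$ by $\widehat D^\omega(\tau)(\theta)=\widehat D^\omega(\tau(\theta))$. Put $\widehat\nabla^\omega=\widehat\Upsilon\circ\widehat D^\omega|_E$, $d^{\widehat\nabla^\omega}(T\otimes\mu)=\widehat\nabla^\omega(T)\mu+T\otimes d\mu$, and $d^{\widehat\nabla^\omega\star}=(-1)^a(\mathrm{id}\otimes\star_q^{-1})\circ d^{\widehat\nabla^\omega}\circ(\mathrm{id}\otimes\star_q)$ on $E\otimes\Omega^{a+1}$. In this setting (where the operator $\widehat S^\omega$ vanishes) the non-commutative geometrical Yang–Mills equation is $d^{\widehat\nabla^\omega\star}(\widehat\Upsilon(R^\omega))=0$, and $\omega$ is called a Yang–Mills quantum principal connection if it satisfies it. *)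

theory Defs
  imports
    "HOL-Analysis.Analysis"
    "HOL-Algebra.Free_Abelian_Groups"
    "HOL-Library.Function_Algebras"
begin

section \<open>Quantum tori\<close>

text \<open>
  An element \<open>\<Sum>\<^sub>k a\<^sub>k u\<^sub>1^k\<^sub>1 \<dots> u\<^sub>m^k\<^sub>m\<close> is its coefficient function. Multi-indices are functions
  \<^typ>\<open>nat \<Rightarrow> int\<close> vanishing outside \<open>{1..m}\<close>, so that the torus on \<open>u\<^sub>1, \<dots>, u\<^sub>n\<close> is literally a
  subset of the one on \<open>u\<^sub>1, \<dots>, u\<^sub>n\<^sub>+\<^sub>1\<close>. Addition, subtraction and \<open>0\<close> on these function types are
  pointwise; the pointwise \<open>*\<close> and \<open>1\<close> that come with the type class instances are never used
  on them.
\<close>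

type_synonym qt = "(nat \<Rightarrow> int) \<Rightarrow> complex"

definition multi_index :: "nat \<Rightarrow> (nat \<Rightarrow> int) set" where
  "multi_index m = {k. \<forall>i. i \<notin> {1..m} \<longrightarrow> k i = 0}"

definition torus :: "nat \<Rightarrow> qt set" where
  "torus m = {a. (\<forall>k. k \<notin> multi_index m \<longrightarrow> a k = 0) \<and>
     (\<forall>N::nat. \<exists>C::real. \<forall>k \<in> multi_index m.
        (1 + (\<Sum>i=1..m. real_of_int \<bar>k i\<bar>)) ^ N * cmod (a k) \<le> C)}"

definition qmon :: "(nat \<Rightarrow> int) \<Rightarrow> qt" where
  "qmon k = (\<lambda>r. if r = k then 1 else 0)"

definition gen :: "nat \<Rightarrow> qt" where
  "gen j = qmon (\<lambda>i. if i = j then 1 else 0)"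

definition tone :: qt where
  "tone = qmon (\<lambda>i. 0)"

text \<open>
  The phase \<open>exp (2\<pi>i \<Sum>\<^sub>j\<^sub><\<^sub>i \<Xi>\<^sub>i\<^sub>j k\<^sub>i l\<^sub>j)\<close> created by putting \<open>u^k u^l\<close> into the normal order
  \<open>u^(k+l)\<close> with \<open>u\<^sub>i u\<^sub>j = exp (2\<pi>i \<Xi>\<^sub>i\<^sub>j) u\<^sub>j u\<^sub>i\<close>. It is finite on multi-indices.
\<close>

definition phase :: "(nat \<Rightarrow> nat \<Rightarrow> real) \<Rightarrow> (nat \<Rightarrow> int) \<Rightarrow> (nat \<Rightarrow> int) \<Rightarrow> complex" where
  "phase \<Xi> k l =
     cis (2 * pi * (\<Sum>(i, j) \<in> {(i, j). j < i \<and> k i \<noteq> 0 \<and> l j \<noteq> 0}.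
       \<Xi> i j * real_of_int (k i) * real_of_int (l j)))"

definition tmul :: "(nat \<Rightarrow> nat \<Rightarrow> real) \<Rightarrow> qt \<Rightarrow> qt \<Rightarrow> qt" where
  "tmul \<Xi> a b = (\<lambda>r. \<Sum>\<^sub>\<infinity>k. phase \<Xi> k (r - k) * a k * b (r - k))"

text \<open>\<open>(u^k)\<^sup>* = u\<^sub>m^(-k\<^sub>m) \<dots> u\<^sub>1^(-k\<^sub>1) = phase k k u^(-k)\<close>, and \<open>phase k k = phase (-k) (-k)\<close>.\<close>

definition tstar :: "(nat \<Rightarrow> nat \<Rightarrow> real) \<Rightarrow> qt \<Rightarrow> qt" where
  "tstar \<Xi> a = (\<lambda>r. phase \<Xi> r r * cnj (a (- r)))"

definition tscale :: "complex \<Rightarrow> qt \<Rightarrow> qt" where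
  "tscale c a = (\<lambda>r. c * a r)"

text \<open>The derivation with \<open>\<delta>\<^sub>j u\<^sub>j = 2\<pi>i u\<^sub>j\<close> and \<open>\<delta>\<^sub>j u\<^sub>k = 0\<close> for \<open>k \<noteq> j\<close>.\<close>

definition delta :: "nat \<Rightarrow> qt \<Rightarrow> qt" where
  "delta j a = (\<lambda>r. 2 * of_real pi * \<i> * of_int (r j) * a r)"

section \<open>Differential forms\<close>

text \<open>
  A form \<open>\<Sum>\<^sub>I x\<^sub>I \<otimes> e\<^sub>I\<close> is the function \<open>I \<mapsto> x\<^sub>I\<close>, where \<open>e\<^sub>I\<close> is the wedge product of the canonical
  basis vectors with indices in \<open>I\<close>, in increasing order.
\<close>

type_synonym form = "nat set \<Rightarrow> qt"

definition Omega :: "nat \<Rightarrow> form set" where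
  "Omega m = {w. \<forall>I. w I \<in> torus m \<and> (\<not> I \<subseteq> {1..m} \<longrightarrow> w I = 0)}"

definition Omega_deg :: "nat \<Rightarrow> nat \<Rightarrow> form set" where
  "Omega_deg k m = {w \<in> Omega m. \<forall>I. card I \<noteq> k \<longrightarrow> w I = 0}"

definition emb :: "qt \<Rightarrow> form" where
  "emb x = (\<lambda>I. if I = {} then x else 0)"

definition fone :: form where
  "fone = emb tone"

definition fscale :: "complex \<Rightarrow> form \<Rightarrow> form" where
  "fscale c w = (\<lambda>I. tscale c (w I))"

text \<open>\<open>e\<^sub>I \<and> e\<^sub>J = wsgn I J e\<^sub>I\<^sub>\<union>\<^sub>J\<close> for disjoint \<open>I\<close> and \<open>J\<close>.\<close>

definition wsgn :: "nat set \<Rightarrow> nat set \<Rightarrow> complex" where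
  "wsgn I J = (-1) ^ card {(i, j). i \<in> I \<and> j \<in> J \<and> j < i}"

definition fmul :: "(nat \<Rightarrow> nat \<Rightarrow> real) \<Rightarrow> form \<Rightarrow> form \<Rightarrow> form" where
  "fmul \<Xi> v w = (\<lambda>K. \<Sum>I \<in> Pow K. tscale (wsgn I (K - I)) (tmul \<Xi> (v I) (w (K - I))))"

definition fstar :: "(nat \<Rightarrow> nat \<Rightarrow> real) \<Rightarrow> form \<Rightarrow> form" where
  "fstar \<Xi> w = (\<lambda>I. tstar \<Xi> (w I))"

text \<open>\<open>dU I\<close> is the product of the \<open>d\<bbbU>\<^sub>j\<close> with \<open>j \<in> I\<close> in increasing order.\<close>

definition dU :: "nat set \<Rightarrow> form" where
  "dU I = (\<lambda>K. if K = I then tone else 0)"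

definition d0 :: "nat \<Rightarrow> (nat \<Rightarrow> nat \<Rightarrow> real) \<Rightarrow> qt \<Rightarrow> form" where
  "d0 m \<Xi> x = fscale \<i> (\<Sum>j=1..m. fmul \<Xi> (emb (delta j x)) (dU {j}))"

definition ext_d :: "nat \<Rightarrow> (nat \<Rightarrow> nat \<Rightarrow> real) \<Rightarrow> form \<Rightarrow> form" where
  "ext_d m \<Xi> w = (\<Sum>I \<in> Pow {1..m}. fmul \<Xi> (d0 m \<Xi> (w I)) (dU I))"

text \<open>
  Hodge operator of the orthonormal canonical basis and the volume form \<open>e\<^sub>1 \<and> \<dots> \<and> e\<^sub>n\<close>:
  \<open>\<star> e\<^sub>I = wsgn I J e\<^sub>J\<close> with \<open>J = {1..n} - I\<close>, so that \<open>e\<^sub>I \<and> \<star> e\<^sub>I\<close> is the volume form.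
\<close>

definition hodge :: "nat \<Rightarrow> form \<Rightarrow> form" where
  "hodge n w = (\<lambda>J. if J \<subseteq> {1..n} then tscale (wsgn ({1..n} - J) J) (w ({1..n} - J)) else 0)"

definition hodge_inv :: "nat \<Rightarrow> form \<Rightarrow> form" where
  "hodge_inv n = inv_into (Omega n) (hodge n)"

text \<open>The formal adjoint of the differential on forms of degree \<open>a + 1\<close>.\<close>

definition d_star :: "nat \<Rightarrow> (nat \<Rightarrow> nat \<Rightarrow> real) \<Rightarrow> nat \<Rightarrow> form \<Rightarrow> form" where
  "d_star n \<Xi> a w = fscale ((-1) ^ a) (hodge_inv n (ext_d n \<Xi> (hodge n w)))"

section \<open>The structure group and the bundle\<close>

text \<open>
  The Laurent polynomials \<open>\<complex>[z, z\<^sup>-\<^sup>1]\<close> are the group algebra \<^typ>\<open>int \<Rightarrow>\<^sub>0 complex\<close>. The line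
  \<open>\<complex>\<vartheta>\<close> is identified with \<^typ>\<open>complex\<close> through the basis vector \<open>\<vartheta>\<close>; since \<open>\<vartheta>\<^sup>* = \<vartheta>\<close>, its
  involution is complex conjugation.
\<close>

type_synonym laurent = "int \<Rightarrow>\<^sub>0 complex"
type_synonym u1 = complex

definition theta :: u1 where
  "theta = 1"

definition zpow :: "int \<Rightarrow> laurent" where
  "zpow k = Poly_Mapping.single k 1"

definition antipode :: "laurent \<Rightarrow> laurent" where
  "antipode g = (\<Sum>k \<in> Poly_Mapping.keys g. Poly_Mapping.single (- k) (Poly_Mapping.lookup g k))"

text \<open>The quantum germs map \<open>\<pi>\<close>, linear with \<open>\<pi>(z^k) = k \<vartheta>\<close>.\<close>

definition germs :: "laurent \<Rightarrow> u1" where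
  "germs g = (\<Sum>k \<in> Poly_Mapping.keys g. Poly_Mapping.lookup g k * (of_int k * theta))"

text \<open>\<open>ad \<vartheta> = \<vartheta> \<otimes> 1\<close>, with values in \<open>\<complex>\<vartheta> \<otimes> \<complex>[z, z\<^sup>-\<^sup>1]\<close>.\<close>

definition ad :: "u1 \<Rightarrow> laurent" where
  "ad t = Poly_Mapping.single 0 t"

text \<open>
  An element \<open>\<Sum>\<^sub>k X\<^sub>k \<otimes> z^k + \<Sum>\<^sub>k Y\<^sub>k \<otimes> z^k \<vartheta>\<close> of \<open>\<Omega>(P) \<otimes> \<Gamma>\<^sup>\<and>\<close> is the pair \<open>(X, Y)\<close>. No finiteness
  in \<open>k\<close> is imposed: the coaction of an infinite sum in \<open>u\<^sub>n\<^sub>+\<^sub>1\<close> is an infinite sum in \<open>z\<close>, so it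
  only exists in a completed tensor product.
\<close>

type_synonym ftens = "(int \<Rightarrow> form) \<times> (int \<Rightarrow> form)"

definition grade_inv :: "form \<Rightarrow> form" where
  "grade_inv w = (\<lambda>I. tscale ((-1) ^ card I) (w I))"

definition fconv :: "(nat \<Rightarrow> nat \<Rightarrow> real) \<Rightarrow> (int \<Rightarrow> form) \<Rightarrow> (int \<Rightarrow> form) \<Rightarrow> int \<Rightarrow> form" where
  "fconv \<Xi> X Y = (\<lambda>k I r. \<Sum>\<^sub>\<infinity>l. fmul \<Xi> (X l) (Y (k - l)) I r)"

text \<open>
  The graded tensor product: \<open>(v \<otimes> g) (w \<otimes> h) = (-1)^(|g| |w|) v w \<otimes> g h\<close>,
  \<open>d (w \<otimes> g) = dw \<otimes> g + (-1)^|w| w \<otimes> dg\<close> with \<open>d z^k = k z^k \<vartheta>\<close>, and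
  \<open>(w \<otimes> g)\<^sup>* = w\<^sup>* \<otimes> g\<^sup>*\<close>.
\<close>

definition xmul :: "(nat \<Rightarrow> nat \<Rightarrow> real) \<Rightarrow> ftens \<Rightarrow> ftens \<Rightarrow> ftens" where
  "xmul \<Xi> A B =
     (fconv \<Xi> (fst A) (fst B),
      fconv \<Xi> (fst A) (snd B) + fconv \<Xi> (snd A) (\<lambda>k. grade_inv (fst B k)))"

definition xd :: "nat \<Rightarrow> (nat \<Rightarrow> nat \<Rightarrow> real) \<Rightarrow> ftens \<Rightarrow> ftens" where
  "xd m \<Xi> A =
     (\<lambda>k. ext_d m \<Xi> (fst A k),
      \<lambda>k. ext_d m \<Xi> (snd A k) + fscale (of_int k) (grade_inv (fst A k)))"

definition xstar :: "(nat \<Rightarrow> nat \<Rightarrow> real) \<Rightarrow> ftens \<Rightarrow> ftens" where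
  "xstar \<Xi> A = (\<lambda>k. fstar \<Xi> (fst A (- k)), \<lambda>k. fstar \<Xi> (snd A (- k)))"

definition xscale :: "complex \<Rightarrow> ftens \<Rightarrow> ftens" where
  "xscale c A = (\<lambda>k. fscale c (fst A k), \<lambda>k. fscale c (snd A k))"

text \<open>\<open>w \<otimes> z^k\<close> and \<open>w \<otimes> \<vartheta>\<close>\<close>

definition xten :: "form \<Rightarrow> int \<Rightarrow> ftens" where
  "xten w k = (\<lambda>l. if l = k then w else 0, 0)"

definition xten_theta :: "form \<Rightarrow> ftens" where
  "xten_theta w = (0, \<lambda>l. if l = 0 then w else 0)"

text \<open>
  The coaction \<open>u\<^sub>i \<mapsto> u\<^sub>i \<otimes> 1\<close> (\<open>i \<le> n\<close>), \<open>u\<^sub>n\<^sub>+\<^sub>1 \<mapsto> u\<^sub>n\<^sub>+\<^sub>1 \<otimes> z\<close>, hence \<open>u^k \<mapsto> u^k \<otimes> z^(k\<^sub>n\<^sub>+\<^sub>1)\<close>.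
\<close>

definition coact :: "nat \<Rightarrow> qt \<Rightarrow> int \<Rightarrow> qt" where
  "coact n x = (\<lambda>k r. if r (Suc n) = k then x r else 0)"

definition coact_form :: "nat \<Rightarrow> qt \<Rightarrow> ftens" where
  "coact_form n x = (\<lambda>k. emb (coact n x k), 0)"

text \<open>
  Since \<open>d\<bbbU>\<^sub>j = - (1/2\<pi>) u\<^sub>j\<^sup>* du\<^sub>j\<close>, the value on \<open>d\<bbbU>\<^sub>j\<close> of a morphism of differential
  \<open>*\<close>-algebras that extends the coaction is the following one, and multiplicativity then gives
  its value on \<open>x d\<bbbU>\<^sub>j\<^sub>1 \<dots> d\<bbbU>\<^sub>j\<^sub>k\<close>.
\<close>

definition coact_dU :: "nat \<Rightarrow> (nat \<Rightarrow> nat \<Rightarrow> real) \<Rightarrow> nat \<Rightarrow> ftens" where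
  "coact_dU n \<Xi> j = xscale (- 1 / (2 * of_real pi))
     (xmul \<Xi> (xstar \<Xi> (coact_form n (gen j))) (xd (Suc n) \<Xi> (coact_form n (gen j))))"

definition coact_Omega :: "nat \<Rightarrow> (nat \<Rightarrow> nat \<Rightarrow> real) \<Rightarrow> form \<Rightarrow> ftens" where
  "coact_Omega n \<Xi> w = (\<Sum>I \<in> Pow {1..Suc n}.
     xmul \<Xi> (coact_form n (w I))
       (foldr (xmul \<Xi>) (map (coact_dU n \<Xi>) (sorted_list_of_set I)) (xten fone 0)))"

definition Hor :: "nat \<Rightarrow> (nat \<Rightarrow> nat \<Rightarrow> real) \<Rightarrow> form set" where
  "Hor n \<Xi> = {w \<in> Omega (Suc n). \<exists>(N::nat) x v.
     (\<forall>i<N. x i \<in> torus (Suc n) \<and> v i \<in> Omega n) \<and>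
     w = (\<Sum>i<N. fmul \<Xi> (emb (x i)) (v i))}"

section \<open>Connections\<close>

definition is_qpc :: "nat \<Rightarrow> (nat \<Rightarrow> nat \<Rightarrow> real) \<Rightarrow> (u1 \<Rightarrow> form) \<Rightarrow> bool" where
  "is_qpc n \<Xi> \<omega> \<longleftrightarrow>
     Vector_Spaces.linear (*) fscale \<omega> \<and>
     (\<forall>t. \<omega> t \<in> Omega_deg 1 (Suc n)) \<and>
     (\<forall>t. coact_Omega n \<Xi> (\<omega> t) =
        (\<lambda>k. \<omega> (Poly_Mapping.lookup (ad t) k), 0) + xten_theta (fscale t fone)) \<and>
     (\<forall>t. \<omega> (cnj t) = fstar \<Xi> (\<omega> t))"

definition omega_c :: "nat \<Rightarrow> (nat \<Rightarrow> nat \<Rightarrow> real) \<Rightarrow> u1 \<Rightarrow> form" where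
  "omega_c n \<Xi> t = fscale t
     (fmul \<Xi> (emb (tstar \<Xi> (gen (Suc n)))) (ext_d (Suc n) \<Xi> (emb (gen (Suc n)))))"

text \<open>The embedded differential is zero, so the curvature is just \<open>d\<omega>\<close>.\<close>

definition curvature :: "nat \<Rightarrow> (nat \<Rightarrow> nat \<Rightarrow> real) \<Rightarrow> (u1 \<Rightarrow> form) \<Rightarrow> u1 \<Rightarrow> form" where
  "curvature n \<Xi> \<omega> t = ext_d (Suc n) \<Xi> (\<omega> t)"

section \<open>Associated modules\<close>

text \<open>The intertwiners \<open>Mor(ad, \<Delta>\<^sub>P)\<close> and \<open>Mor(ad, \<Delta>\<^sub>H\<^sub>o\<^sub>r)\<close>.\<close>

definition Mor_P :: "nat \<Rightarrow> (u1 \<Rightarrow> qt) set" where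
  "Mor_P n = {T. Vector_Spaces.linear (*) tscale T \<and>
     (\<forall>t. T t \<in> torus (Suc n) \<and>
          coact n (T t) = (\<lambda>k. T (Poly_Mapping.lookup (ad t) k)))}"

definition Mor_Hor :: "nat \<Rightarrow> (nat \<Rightarrow> nat \<Rightarrow> real) \<Rightarrow> (u1 \<Rightarrow> form) set" where
  "Mor_Hor n \<Xi> = {\<tau>. Vector_Spaces.linear (*) fscale \<tau> \<and>
     (\<forall>t. \<tau> t \<in> Hor n \<Xi> \<and>
          coact_Omega n \<Xi> (\<tau> t) = (\<lambda>k. \<tau> (Poly_Mapping.lookup (ad t) k), 0))}"

text \<open>
  The balanced tensor product of the right module \<open>Mor(ad, \<Delta>\<^sub>P)\<close> with the left module of base
  forms: the free abelian group on pairs modulo biadditivity and \<open>T b \<otimes> \<mu> = T \<otimes> b \<mu>\<close>. Complex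
  linearity is the case of scalar \<open>b\<close>.
\<close>

type_synonym epair = "(u1 \<Rightarrow> qt) \<times> form"

definition Efree :: "nat \<Rightarrow> (epair \<Rightarrow>\<^sub>0 int) monoid" where
  "Efree n = free_Abelian_group (Mor_P n \<times> Omega n)"

definition Erel :: "nat \<Rightarrow> (nat \<Rightarrow> nat \<Rightarrow> real) \<Rightarrow> (epair \<Rightarrow>\<^sub>0 int) set" where
  "Erel n \<Xi> =
     {frag_of (T + T', \<mu>) - frag_of (T, \<mu>) - frag_of (T', \<mu>) |T T' \<mu>.
        T \<in> Mor_P n \<and> T' \<in> Mor_P n \<and> \<mu> \<in> Omega n} \<union>
     {frag_of (T, \<mu> + \<mu>') - frag_of (T, \<mu>) - frag_of (T, \<mu>') |T \<mu> \<mu>'.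
        T \<in> Mor_P n \<and> \<mu> \<in> Omega n \<and> \<mu>' \<in> Omega n} \<union>
     {frag_of (\<lambda>t. tmul \<Xi> (T t) b, \<mu>) - frag_of (T, fmul \<Xi> (emb b) \<mu>) |T b \<mu>.
        T \<in> Mor_P n \<and> b \<in> torus n \<and> \<mu> \<in> Omega n}"

definition EOmega :: "nat \<Rightarrow> (nat \<Rightarrow> nat \<Rightarrow> real) \<Rightarrow> (epair \<Rightarrow>\<^sub>0 int) set monoid" where
  "EOmega n \<Xi> = Efree n Mod generate (Efree n) (Erel n \<Xi>)"

definition tens :: "nat \<Rightarrow> (nat \<Rightarrow> nat \<Rightarrow> real) \<Rightarrow> (u1 \<Rightarrow> qt) \<Rightarrow> form \<Rightarrow> (epair \<Rightarrow>\<^sub>0 int) set" where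
  "tens n \<Xi> T \<mu> = generate (Efree n) (Erel n \<Xi>) #>\<^bsub>Efree n\<^esub> frag_of (T, \<mu>)"

text \<open>
  The homomorphism from the tensor product to the abelian group \<open>B\<close> with \<open>T \<otimes> \<mu> \<mapsto> f T \<mu>\<close>, for
  biadditive balanced \<open>f\<close>.
\<close>

definition tens_lift :: "('b, 'c) monoid_scheme \<Rightarrow> ((u1 \<Rightarrow> qt) \<Rightarrow> form \<Rightarrow> 'b) \<Rightarrow>
    (epair \<Rightarrow>\<^sub>0 int) set \<Rightarrow> 'b" where
  "tens_lift B f C = the_elem
     ((\<lambda>c. finprod B (\<lambda>p. f (fst p) (snd p) [^]\<^bsub>B\<^esub> Poly_Mapping.lookup c p)
             (Poly_Mapping.keys c)) ` C)"

definition Mor_Hor_group :: "nat \<Rightarrow> (nat \<Rightarrow> nat \<Rightarrow> real) \<Rightarrow> (u1 \<Rightarrow> form) monoid" where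
  "Mor_Hor_group n \<Xi> = \<lparr>carrier = Mor_Hor n \<Xi>, monoid.mult = (+), one = 0\<rparr>"

text \<open>\<open>T \<otimes> \<mu> \<mapsto> T \<mu>\<close> and its inverse\<close>

definition Upsilon_inv :: "nat \<Rightarrow> (nat \<Rightarrow> nat \<Rightarrow> real) \<Rightarrow> (epair \<Rightarrow>\<^sub>0 int) set \<Rightarrow> u1 \<Rightarrow> form" where
  "Upsilon_inv n \<Xi> = tens_lift (Mor_Hor_group n \<Xi>) (\<lambda>T \<mu> t. fmul \<Xi> (emb (T t)) \<mu>)"

definition Upsilon :: "nat \<Rightarrow> (nat \<Rightarrow> nat \<Rightarrow> real) \<Rightarrow> (u1 \<Rightarrow> form) \<Rightarrow> (epair \<Rightarrow>\<^sub>0 int) set" where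
  "Upsilon n \<Xi> = inv_into (carrier (EOmega n \<Xi>)) (Upsilon_inv n \<Xi>)"

section \<open>The Yang--Mills equation\<close>

text \<open>
  For horizontal \<open>\<phi>\<close> with coaction \<open>\<Sum>\<^sub>k \<phi>\<^sub>k \<otimes> z^k\<close> this is
  \<open>d\<phi> + \<Sum>\<^sub>k \<omega>(\<pi>(S\<^sup>-\<^sup>1(z^k))) \<phi>\<^sub>k\<close>.
\<close>

definition dual_D :: "nat \<Rightarrow> (nat \<Rightarrow> nat \<Rightarrow> real) \<Rightarrow> (u1 \<Rightarrow> form) \<Rightarrow> form \<Rightarrow> form" where
  "dual_D n \<Xi> \<omega> \<phi> = ext_d (Suc n) \<Xi> \<phi> +
     (\<lambda>I r. \<Sum>\<^sub>\<infinity>k. fmul \<Xi> (\<omega> (germs (inv_into UNIV antipode (zpow k)))) (fst (coact_Omega n \<Xi> \<phi>) k) I r)"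

definition nabla :: "nat \<Rightarrow> (nat \<Rightarrow> nat \<Rightarrow> real) \<Rightarrow> (u1 \<Rightarrow> form) \<Rightarrow> (u1 \<Rightarrow> qt) \<Rightarrow>
    (epair \<Rightarrow>\<^sub>0 int) set" where
  "nabla n \<Xi> \<omega> T = Upsilon n \<Xi> (\<lambda>t. dual_D n \<Xi> \<omega> (emb (T t)))"

definition id_tens :: "nat \<Rightarrow> (nat \<Rightarrow> nat \<Rightarrow> real) \<Rightarrow> (form \<Rightarrow> form) \<Rightarrow>
    (epair \<Rightarrow>\<^sub>0 int) set \<Rightarrow> (epair \<Rightarrow>\<^sub>0 int) set" where
  "id_tens n \<Xi> f = tens_lift (EOmega n \<Xi>) (\<lambda>T \<mu>. tens n \<Xi> T (f \<mu>))"

definition tens_rmul :: "nat \<Rightarrow> (nat \<Rightarrow> nat \<Rightarrow> real) \<Rightarrow> (epair \<Rightarrow>\<^sub>0 int) set \<Rightarrow> form \<Rightarrow>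
    (epair \<Rightarrow>\<^sub>0 int) set" where
  "tens_rmul n \<Xi> C \<mu> = id_tens n \<Xi> (\<lambda>\<nu>. fmul \<Xi> \<nu> \<mu>) C"

definition d_nabla :: "nat \<Rightarrow> (nat \<Rightarrow> nat \<Rightarrow> real) \<Rightarrow> (u1 \<Rightarrow> form) \<Rightarrow>
    (epair \<Rightarrow>\<^sub>0 int) set \<Rightarrow> (epair \<Rightarrow>\<^sub>0 int) set" where
  "d_nabla n \<Xi> \<omega> = tens_lift (EOmega n \<Xi>)
     (\<lambda>T \<mu>. tens_rmul n \<Xi> (nabla n \<Xi> \<omega> T) \<mu> \<otimes>\<^bsub>EOmega n \<Xi>\<^esub> tens n \<Xi> T (ext_d n \<Xi> \<mu>))"

text \<open>The operator on \<open>E \<otimes> \<Omega>\<^sup>a\<^sup>+\<^sup>1\<close>; the tensor product is written multiplicatively as a group.\<close>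

definition d_nabla_star :: "nat \<Rightarrow> (nat \<Rightarrow> nat \<Rightarrow> real) \<Rightarrow> (u1 \<Rightarrow> form) \<Rightarrow> nat \<Rightarrow>
    (epair \<Rightarrow>\<^sub>0 int) set \<Rightarrow> (epair \<Rightarrow>\<^sub>0 int) set" where
  "d_nabla_star n \<Xi> \<omega> a C =
     id_tens n \<Xi> (hodge_inv n) (d_nabla n \<Xi> \<omega> (id_tens n \<Xi> (hodge n) C))
       [^]\<^bsub>EOmega n \<Xi>\<^esub> ((-1) ^ a :: int)"

definition yang_mills :: "nat \<Rightarrow> (nat \<Rightarrow> nat \<Rightarrow> real) \<Rightarrow> (u1 \<Rightarrow> form) \<Rightarrow> bool" where
  "yang_mills n \<Xi> \<omega> \<longleftrightarrow> is_qpc n \<Xi> \<omega> \<and>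
     d_nabla_star n \<Xi> \<omega> 1 (Upsilon n \<Xi> (curvature n \<Xi> \<omega>)) = \<one>\<^bsub>EOmega n \<Xi>\<^esub>"

end

theory Submission
  imports Defs
begin

text \<open>
  The module \<open>E = Mor(ad, \<Delta>\<^sub>P)\<close> is free of rank one over the base algebra. Since \<open>ad \<vartheta> = \<vartheta> \<otimes> 1\<close>, an
  intertwiner \<open>T\<close> is determined by the coinvariant element \<open>T \<vartheta>\<close>, and the coinvariant elements of
  the algebra on \<open>u\<^sub>1, \<dots>, u\<^sub>n\<^sub>+\<^sub>1\<close> are those in which \<open>u\<^sub>n\<^sub>+\<^sub>1\<close> does not occur (\<open>Mor_P_eq\<close>). The generator
  is \<open>T\<^sub>0\<close> with \<open>T\<^sub>0 \<vartheta> = 1\<close>. Hence \<open>T \<otimes> \<mu> = T\<^sub>0 \<otimes> T(\<vartheta>) \<mu>\<close>, every tensor is \<open>T\<^sub>0 \<otimes> v\<close> for exactly one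
  base form \<open>v\<close> (\<open>EOmega_carrier\<close>, \<open>unit_tens_inj\<close>), and \<open>E \<otimes> \<Omega>\<close> is the additive group of base
  forms. In the same way the horizontal intertwiners are the maps \<open>t \<mapsto> t v\<close> (\<open>Mor_Hor_eq\<close>).

  The theorem says that under this identification the operators of the Yang--Mills equation become
  the ordinary ones. Coinvariant elements have charge \<open>0\<close> and \<open>\<pi>(1) = 0\<close>, so the connection term of
  the dual covariant derivative vanishes on them, whatever the connection is (\<open>dual_D_base\<close>); thus
  \<open>\<nabla> T = T\<^sub>0 \<otimes> d(T \<vartheta>)\<close>. By the Leibniz rule, \<open>\<nabla>(T) \<mu> + T \<otimes> d\<mu>\<close> is then \<open>T\<^sub>0 \<otimes> d(T(\<vartheta>) \<mu>)\<close>, which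
  identifies the twisted differential with \<open>d\<close> (\<open>d_nabla_unit_tens\<close>). The Hodge operator and its
  inverse commute with multiplication from the left by the algebra, so \<open>id \<otimes> \<star>\<close> becomes \<open>\<star>\<close>. The form
  \<open>\<omega>\<^sup>c \<vartheta>\<close> is a constant multiple of \<open>d\<bbbU>\<^sub>n\<^sub>+\<^sub>1\<close> and hence closed, so the curvature is the map
  \<open>t \<mapsto> t d\<mu>\<close> (\<open>curvature_eq\<close>). The left side of the Yang--Mills equation is therefore \<open>T\<^sub>0 \<otimes> - v\<close> with
  \<open>v = \<star>\<^sup>-\<^sup>1 d \<star> d\<mu>\<close>, while \<open>- v\<close> is also the formal adjoint of \<open>d\<close> applied to \<open>d\<mu>\<close>.

  The operators on the tensor product are given as values of maps on cosets of the free abelian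
  group on pairs, and such a value is meaningful only if the map respects the relations of the
  tensor product. One universal property, \<open>tens_lift_base\<close>, settles this for all of them: each
  operator sends \<open>T \<otimes> \<mu>\<close> to \<open>g(T(\<vartheta>) \<mu>)\<close> for an additive \<open>g\<close>. That expressions of this form respect the
  relations uses that base forms are an associative left module over the algebra. The analytic
  part of the proof provides this: rapidly decaying sequences are closed under the twisted
  convolution (\<open>tmul_closed\<close>), which is associative (\<open>tmul_assoc\<close>) and for which the \<open>\<delta>\<^sub>j\<close> are
  derivations (\<open>delta_tmul\<close>).
\<close>

section \<open>The algebra of rapidly decaying sequences\<close>

definition weight :: "nat \<Rightarrow> (nat \<Rightarrow> int) \<Rightarrow> real" where
  "weight m k = 1 + (\<Sum>i=1..m. real_of_int \<bar>k i\<bar>)"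

text \<open>
  A coefficient function vanishes outside the multi-indices, so the decay bounds may be asked for at
  every index; convolutions then run over the whole index type.
\<close>

lemma torus_iff:
  "a \<in> torus m \<longleftrightarrow> (\<forall>k. k \<notin> multi_index m \<longrightarrow> a k = 0) \<and>
     (\<forall>N. \<exists>C. \<forall>k. weight m k ^ N * cmod (a k) \<le> C)"
proof -
  have "(\<exists>C. \<forall>k. weight m k ^ N * cmod (a k) \<le> C) \<longleftrightarrow>
        (\<exists>C. \<forall>k\<in>multi_index m. weight m k ^ N * cmod (a k) \<le> C)"
    if *: "\<forall>k. k \<notin> multi_index m \<longrightarrow> a k = 0" for N
  proof
    assume "\<exists>C. \<forall>k\<in>multi_index m. weight m k ^ N * cmod (a k) \<le> C"
    then obtain C where C: "\<forall>k\<in>multi_index m. weight m k ^ N * cmod (a k) \<le> C" by blast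
    have "weight m k ^ N * cmod (a k) \<le> max C 0" for k
      using C * by (cases "k \<in> multi_index m") (force simp: max_def)+
    then show "\<exists>C. \<forall>k. weight m k ^ N * cmod (a k) \<le> C" by blast
  qed blast
  then show ?thesis
    unfolding torus_def weight_def[symmetric] by auto
qed

lemma torus_outside: "a \<in> torus m \<Longrightarrow> k \<notin> multi_index m \<Longrightarrow> a k = 0"
  by (simp add: torus_iff)

lemma weight_ge_1: "1 \<le> weight m k"
  by (simp add: weight_def sum_nonneg)

lemma weight_pos: "0 < weight m k"
  using weight_ge_1[of m k] by linarith

text \<open>
  Submultiplicativity splits the weight at the index \<open>k + l\<close> of a convolution between the two
  factors; this is why decay of both factors gives decay of the product.
\<close>

lemma weight_add: "weight m (k + l) \<le> weight m k * weight m l"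
proof -
  have "weight m (k + l) \<le> 1 + ((\<Sum>i=1..m. real_of_int \<bar>k i\<bar>) + (\<Sum>i=1..m. real_of_int \<bar>l i\<bar>))"
    unfolding weight_def sum.distrib[symmetric] by (intro add_left_mono sum_mono) simp
  also have "\<dots> \<le> weight m k * weight m l"
    by (simp add: weight_def algebra_simps sum_nonneg mult_nonneg_nonneg)
  finally show ?thesis .
qed

lemma torus_bounded:
  assumes "a \<in> torus m"
  obtains C where "\<And>k. weight m k ^ N * cmod (a k) \<le> C" "0 \<le> C"
proof -
  obtain C where C: "\<And>k. weight m k ^ N * cmod (a k) \<le> C"
    using assms unfolding torus_iff by blast
  have "0 \<le> weight m 0 ^ N * cmod (a 0)" using weight_pos[of m 0] by simp
  then have "0 \<le> C" using C[of 0] by (rule order_trans)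
  with C show ?thesis by (rule that)
qed

lemma multi_index_add: "k \<in> multi_index m \<Longrightarrow> l \<in> multi_index m \<Longrightarrow> k + l \<in> multi_index m"
  by (simp add: multi_index_def)

lemma inverse_square_summable_on_int:
  "(\<lambda>z::int. inverse ((1 + real_of_int \<bar>z\<bar>) ^ 2)) summable_on UNIV"
proof -
  let ?f = "\<lambda>z::int. inverse ((1 + real_of_int \<bar>z\<bar>) ^ 2)"
  have "summable (\<lambda>n. inverse (real (Suc n) ^ 2))"
    using inverse_power_summable[of 2, where ?'a=real] by (subst summable_Suc_iff) simp
  then have nat: "(\<lambda>n. inverse ((1 + real n) ^ 2)) summable_on UNIV"
    by (subst summable_on_UNIV_nonneg_real_iff) (simp_all only: of_nat_Suc, simp_all)
  have "?f summable_on range int"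
    by (subst summable_on_reindex) (use nat in \<open>simp_all add: o_def\<close>)
  moreover have "?f summable_on range (\<lambda>n. - int n)"
    by (subst summable_on_reindex) (use nat in \<open>simp_all add: o_def inj_on_def\<close>)
  moreover have "(UNIV :: int set) = range int \<union> range (\<lambda>n. - int n)"
  proof (intro equalityI subsetI)
    fix z :: int
    show "z \<in> range int \<union> range (\<lambda>n. - int n)"
      by (cases z rule: int_cases2) auto
  qed simp
  ultimately show ?thesis
    by (metis summable_on_union)
qed

text \<open>
  A multi-index of length \<open>m + 1\<close> is a multi-index of length \<open>m\<close> together with an integer, and a
  product of a summable family in the first and one in the second is summable on pairs.
\<close>

lemma multi_index_summable:
  fixes g :: "int \<Rightarrow> real"
  assumes nonneg: "\<And>z. 0 \<le> g z" and summ: "g summable_on UNIV"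
  shows "(\<lambda>k. \<Prod>i=1..m. g (k i)) summable_on multi_index m"
proof (induction m)
  case 0
  have "multi_index 0 = {0}" by (auto simp: multi_index_def)
  then show ?case by simp
next
  case (Suc m)
  define G where "G k = (\<Prod>i=1..m. g (k i))" for k :: "nat \<Rightarrow> int"
  have G: "0 \<le> G k" for k unfolding G_def by (intro prod_nonneg) (simp add: nonneg)
  define e where "e = (\<lambda>(k :: nat \<Rightarrow> int, z). k(Suc m := z))"
  have inj: "inj_on e (multi_index m \<times> UNIV)"
  proof (rule inj_onI, clarify)
    fix k z k' z'
    assume *: "k \<in> multi_index m" "k' \<in> multi_index m" "e (k, z) = e (k', z')"
    have eq: "(k(Suc m := z)) i = (k'(Suc m := z')) i" for i using *(3) by (simp add: e_def)
    have "k i = k' i" for i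
      using *(1,2) eq[of i] by (cases "i = Suc m") (simp_all add: multi_index_def)
    with eq[of "Suc m"] show "k = k' \<and> z = z'" by auto
  qed
  have img: "e ` (multi_index m \<times> UNIV) = multi_index (Suc m)"
  proof
    show "multi_index (Suc m) \<subseteq> e ` (multi_index m \<times> UNIV)"
    proof
      fix k assume k: "k \<in> multi_index (Suc m)"
      have "k = e (k(Suc m := 0), k (Suc m))" by (simp add: e_def)
      moreover have "k(Suc m := 0) \<in> multi_index m"
        using k by (auto simp: multi_index_def)
      ultimately show "k \<in> e ` (multi_index m \<times> UNIV)" by blast
    qed
  qed (auto simp: multi_index_def e_def)
  have "Infinite_Sum.abs_summable_on (\<lambda>(k, z). G k * g z) (multi_index m \<times> UNIV)"
    unfolding Infinite_Sum.abs_summable_on_Sigma_iff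
  proof (intro conjI ballI)
    fix k
    show "Infinite_Sum.abs_summable_on (\<lambda>z. (\<lambda>(k, z). G k * g z) (k, z)) UNIV"
      using summ by (simp add: abs_mult nonneg G summable_on_cmult_right)
  next
    have "(\<Sum>\<^sub>\<infinity>z. norm ((\<lambda>(k, z). G k * g z) (k, z))) = G k * (\<Sum>\<^sub>\<infinity>z. g z)" for k
      by (simp add: abs_mult nonneg G infsum_cmult_right')
    moreover have "(\<lambda>k. G k * (\<Sum>\<^sub>\<infinity>z. g z)) summable_on multi_index m"
      using Suc unfolding G_def by (rule summable_on_cmult_left)
    ultimately show "Infinite_Sum.abs_summable_on
        (\<lambda>k. \<Sum>\<^sub>\<infinity>z. norm ((\<lambda>(k, z). G k * g z) (k, z))) (multi_index m)"
      by (simp add: abs_mult nonneg G infsum_nonneg)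
  qed
  then have "(\<lambda>(k, z). G k * g z) summable_on (multi_index m \<times> UNIV)"
    by (rule Infinite_Sum.abs_summable_summable)
  moreover have "(\<lambda>(k, z). G k * g z) = (\<lambda>k. \<Prod>i=1..Suc m. g (k i)) \<circ> e"
  proof (rule ext, rule prod.exhaust)
    fix p k z assume p: "p = (k :: nat \<Rightarrow> int, z :: int)"
    have "(\<Prod>i=1..m. g (if i = Suc m then z else k i)) = (\<Prod>i=1..m. g (k i))"
      by (intro prod.cong) auto
    then show "(\<lambda>(k, z). G k * g z) p = ((\<lambda>k. \<Prod>i=1..Suc m. g (k i)) \<circ> e) p"
      by (simp add: p e_def G_def)
  qed
  ultimately have "(\<lambda>k. \<Prod>i=1..Suc m. g (k i)) \<circ> e summable_on (multi_index m \<times> UNIV)"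
    by simp
  then have "(\<lambda>k. \<Prod>i=1..Suc m. g (k i)) summable_on e ` (multi_index m \<times> UNIV)"
    by (subst summable_on_reindex[OF inj])
  then show ?case unfolding img .
qed

text \<open>
  Decay of order \<open>2 m\<close> is enough, because every factor \<open>1 + |k\<^sub>i|\<close> is at most the weight of \<open>k\<close>.
\<close>

lemma torus_abs_summable:
  assumes "a \<in> torus m"
  shows "(\<lambda>k. cmod (a k)) summable_on UNIV"
proof -
  obtain C where C: "\<And>k. weight m k ^ (2 * m) * cmod (a k) \<le> C" "0 \<le> C"
    using torus_bounded[OF assms] by blast
  let ?G = "\<lambda>k :: nat \<Rightarrow> int. \<Prod>i=1..m. inverse ((1 + real_of_int \<bar>k i\<bar>) ^ 2)"
  have le: "cmod (a k) \<le> C * ?G k" for k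
  proof -
    have "(\<Prod>i=1..m. (1 + real_of_int \<bar>k i\<bar>) ^ 2) \<le> (\<Prod>i=1..m. weight m k ^ 2)"
    proof (intro prod_mono conjI power_mono)
      fix i assume "i \<in> {1..m}"
      then have "real_of_int \<bar>k i\<bar> \<le> (\<Sum>i=1..m. real_of_int \<bar>k i\<bar>)"
        by (intro member_le_sum) auto
      then show "1 + real_of_int \<bar>k i\<bar> \<le> weight m k" by (simp add: weight_def)
    qed auto
    then have "(\<Prod>i=1..m. (1 + real_of_int \<bar>k i\<bar>) ^ 2) * cmod (a k) \<le> weight m k ^ (2 * m) * cmod (a k)"
      by (intro mult_right_mono) (simp_all add: power_mult)
    also have "\<dots> \<le> C" by (rule C)
    finally have *: "(\<Prod>i=1..m. (1 + real_of_int \<bar>k i\<bar>) ^ 2) * cmod (a k) \<le> C" .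
    have pos: "0 < (\<Prod>i=1..m. (1 + real_of_int \<bar>k i\<bar>) ^ 2)"
      by (intro prod_pos) (simp add: add_pos_nonneg)
    have "?G k = inverse (\<Prod>i=1..m. (1 + real_of_int \<bar>k i\<bar>) ^ 2)"
      using prod_inversef[of "\<lambda>i. (1 + real_of_int \<bar>k i\<bar>) ^ 2" "{1..m}"] by (simp only: o_def)
    then have "C * ?G k = C / (\<Prod>i=1..m. (1 + real_of_int \<bar>k i\<bar>) ^ 2)"
      by (simp only: divide_inverse)
    with * show ?thesis by (simp only: pos_le_divide_eq[OF pos] mult.commute)
  qed
  have "(\<lambda>k. C * ?G k) summable_on multi_index m"
    using inverse_square_summable_on_int
    by (intro summable_on_cmult_right multi_index_summable) auto
  then have "(\<lambda>k. cmod (a k)) summable_on multi_index m"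
    by (rule summable_on_comparison_test) (use le in auto)
  moreover have "(\<lambda>k. cmod (a k)) summable_on multi_index m \<longleftrightarrow> (\<lambda>k. cmod (a k)) summable_on UNIV"
    by (rule summable_on_cong_neutral) (use torus_outside[OF assms] in auto)
  ultimately show ?thesis by simp
qed

lemma torus_weighted:
  assumes "a \<in> torus m"
  shows "(\<lambda>k. complex_of_real (weight m k ^ N) * a k) \<in> torus m"
  unfolding torus_iff
proof (intro conjI allI impI)
  fix M
  obtain C where "\<And>k. weight m k ^ (M + N) * cmod (a k) \<le> C"
    using torus_bounded[OF assms] by metis
  then show "\<exists>C. \<forall>k. weight m k ^ M * cmod (complex_of_real (weight m k ^ N) * a k) \<le> C"
    using weight_pos[of m]
    by (intro exI[of _ C]) (simp add: norm_mult power_add norm_power mult.assoc less_imp_le)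
qed (use torus_outside[OF assms] in auto)

lemma torus_zero: "0 \<in> torus m"
  by (auto simp: torus_iff)

lemma torus_add:
  assumes "a \<in> torus m" "b \<in> torus m"
  shows "a + b \<in> torus m"
  unfolding torus_iff
proof (intro conjI allI impI)
  fix N
  obtain C D where *: "\<And>k. weight m k ^ N * cmod (a k) \<le> C" "\<And>k. weight m k ^ N * cmod (b k) \<le> D"
    using torus_bounded assms by metis
  have "weight m k ^ N * cmod ((a + b) k) \<le> C + D" for k
  proof -
    have "weight m k ^ N * cmod ((a + b) k) \<le> weight m k ^ N * (cmod (a k) + cmod (b k))"
      using weight_pos[of m k] by (intro mult_left_mono) (simp_all add: norm_triangle_ineq)
    also have "\<dots> \<le> C + D" using *[of k] by (simp add: distrib_left)
    finally show ?thesis .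
  qed
  then show "\<exists>C. \<forall>k. weight m k ^ N * cmod ((a + b) k) \<le> C" by blast
qed (simp add: torus_outside[OF assms(1)] torus_outside[OF assms(2)])

lemma torus_scale:
  assumes "a \<in> torus m"
  shows "tscale c a \<in> torus m"
  unfolding torus_iff
proof (intro conjI allI impI)
  fix N
  obtain C where C: "\<And>k. weight m k ^ N * cmod (a k) \<le> C"
    using torus_bounded[OF assms] by metis
  have "weight m k ^ N * cmod (tscale c a k) \<le> cmod c * C" for k
    using mult_left_mono[OF C[of k], of "cmod c"] by (simp add: tscale_def norm_mult ac_simps)
  then show "\<exists>C. \<forall>k. weight m k ^ N * cmod (tscale c a k) \<le> C" by blast
qed (use assms torus_outside in \<open>auto simp: tscale_def\<close>)

text \<open>
  The derivation multiplies the coefficient of \<open>u^k\<close> by \<open>2 \<pi> i k\<^sub>j\<close>, which costs one order of decay.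
\<close>

lemma torus_delta:
  assumes "a \<in> torus m"
  shows "delta j a \<in> torus m"
  unfolding torus_iff
proof (intro conjI allI impI)
  fix N
  obtain C where C: "\<And>k. weight m k ^ Suc N * cmod (a k) \<le> C"
    using torus_bounded[OF assms] by metis
  have "weight m k ^ N * cmod (delta j a k) \<le> 2 * pi * C" for k
  proof (cases "k \<in> multi_index m")
    case True
    have "real_of_int \<bar>k j\<bar> \<le> weight m k"
    proof (cases "j \<in> {1..m}")
      case True
      then have "real_of_int \<bar>k j\<bar> \<le> (\<Sum>i=1..m. real_of_int \<bar>k i\<bar>)"
        by (intro member_le_sum) auto
      then show ?thesis by (simp add: weight_def)
    next
      case False
      with \<open>k \<in> multi_index m\<close> show ?thesis
        using weight_pos[of m k] by (simp add: multi_index_def)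
    qed
    then have "real_of_int \<bar>k j\<bar> * (weight m k ^ N * cmod (a k)) \<le> weight m k * (weight m k ^ N * cmod (a k))"
      using weight_pos[of m k] by (intro mult_right_mono) simp_all
    also have "\<dots> \<le> C" using C[of k] by (simp add: ac_simps)
    finally have "2 * pi * (real_of_int \<bar>k j\<bar> * (weight m k ^ N * cmod (a k))) \<le> 2 * pi * C"
      by (intro mult_left_mono) simp_all
    then show ?thesis
      by (simp add: delta_def norm_mult ac_simps)
  next
    case False
    have "0 \<le> C" using order_trans[OF _ C[of k]] weight_pos[of m k] by simp
    with False show ?thesis by (simp add: delta_def torus_outside[OF assms])
  qed
  then show "\<exists>C. \<forall>k. weight m k ^ N * cmod (delta j a k) \<le> C" by blast
qed (use assms torus_outside in \<open>auto simp: delta_def\<close>)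

lemma qmon_in_torus:
  assumes "k \<in> multi_index m"
  shows "qmon k \<in> torus m"
  unfolding torus_iff
proof (intro conjI allI impI)
  fix N
  show "\<exists>C. \<forall>r. weight m r ^ N * cmod (qmon k r) \<le> C"
    using weight_pos[of m k] by (intro exI[of _ "weight m k ^ N"]) (auto simp: qmon_def)
qed (use assms in \<open>auto simp: qmon_def\<close>)

lemma tone_in_torus: "tone \<in> torus m"
  unfolding tone_def by (rule qmon_in_torus) (simp add: multi_index_def)

lemma norm_phase: "cmod (phase \<Xi> k l) = 1"
  by (simp add: phase_def)

text \<open>
  The exponent of the phase is summed over the supports of \<open>k\<close> and \<open>l\<close>. Extended to a fixed box it
  is visibly additive in \<open>k\<close> and in \<open>l\<close>.
\<close>

lemma phase_multi_index:
  assumes "k \<in> multi_index m" "l \<in> multi_index m"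
  shows "phase \<Xi> k l = cis (2 * pi * (\<Sum>i=1..m. \<Sum>j=1..m.
           if j < i then \<Xi> i j * real_of_int (k i) * real_of_int (l j) else 0))"
proof -
  have "(\<Sum>(i, j) \<in> {(i, j). j < i \<and> k i \<noteq> 0 \<and> l j \<noteq> 0}. \<Xi> i j * real_of_int (k i) * real_of_int (l j))
      = (\<Sum>(i, j) \<in> {1..m} \<times> {1..m}.
           if j < i then \<Xi> i j * real_of_int (k i) * real_of_int (l j) else 0)"
    by (rule sum.mono_neutral_cong_left)
       (use assms in \<open>auto simp: multi_index_def split: if_splits\<close>)
  then show ?thesis
    by (simp add: phase_def sum.cartesian_product)
qed

text \<open>
  With a biadditive exponent \<open>B\<close>, both sides are the phase of \<open>B k l + B k r + B l r\<close>.
\<close>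

lemma phase_cocycle:
  assumes "k \<in> multi_index m" "l \<in> multi_index m" "r \<in> multi_index m"
  shows "phase \<Xi> k l * phase \<Xi> (k + l) r = phase \<Xi> k (l + r) * phase \<Xi> l r"
proof -
  define B where "B k l = (\<Sum>i=1..m. \<Sum>j=1..m.
           if j < i then \<Xi> i j * real_of_int (k i) * real_of_int (l j) else 0)" for k l :: "nat \<Rightarrow> int"
  have ph: "phase \<Xi> k l = cis (2 * pi * B k l)" if "k \<in> multi_index m" "l \<in> multi_index m" for k l
    using phase_multi_index[OF that] by (simp add: B_def)
  have l: "B (k + l) r = B k r + B l r" for k l r
    unfolding B_def sum.distrib[symmetric] by (intro sum.cong refl) (simp add: algebra_simps)
  have r: "B k (l + r) = B k l + B k r" for k l r
    unfolding B_def sum.distrib[symmetric] by (intro sum.cong refl) (simp add: algebra_simps)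
  show ?thesis
    using assms by (simp add: ph multi_index_add cis_mult l r algebra_simps)
qed

lemma phase_zero_left [simp]: "phase \<Xi> 0 l = 1"
  by (simp add: phase_def)

lemma phase_zero_right [simp]: "phase \<Xi> k 0 = 1"
  by (simp add: phase_def)

lemma bij_diff_left: "bij_betw (\<lambda>k. k - l) UNIV (UNIV :: (nat \<Rightarrow> int) set)"
  by (rule bij_betw_byWitness[where f'="\<lambda>k. k + l"]) auto

text \<open>
  One factor is absolutely summable and the other one is bounded.
\<close>

lemma tmul_abs_summable:
  assumes "a \<in> torus m" "b \<in> torus m"
  shows "(\<lambda>k. cmod (phase \<Xi> k (r - k) * a k * b (r - k))) summable_on UNIV"
proof -
  obtain C where C: "\<And>k. weight m k ^ 0 * cmod (b k) \<le> C" "0 \<le> C"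
    using torus_bounded[OF assms(2)] by metis
  have "Infinite_Sum.abs_summable_on (\<lambda>k. of_real C * a k) UNIV"
    using torus_abs_summable[OF assms(1)] C by (simp add: norm_mult summable_on_cmult_right)
  then show ?thesis
  proof (rule Infinite_Sum.abs_summable_on_comparison_test)
    fix k
    show "norm (phase \<Xi> k (r - k) * a k * b (r - k)) \<le> norm (of_real C * a k)"
      using mult_right_mono[OF C(1)[of "r - k"], of "cmod (a k)"] C(2)
      by (simp add: norm_mult norm_phase ac_simps)
  qed
qed

lemma tmul_summable:
  assumes "a \<in> torus m" "b \<in> torus m"
  shows "(\<lambda>k. phase \<Xi> k (r - k) * a k * b (r - k)) summable_on UNIV"
  by (rule Infinite_Sum.abs_summable_summable, rule tmul_abs_summable[OF assms])

text \<open>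
  The weight of order \<open>N\<close> at \<open>r\<close> is at most the product of those at \<open>k\<close> and \<open>r - k\<close>. The second one is
  absorbed by the decay of \<open>b\<close>, and the sequence \<open>a\<close> stays summable with the first.
\<close>

lemma tmul_closed:
  assumes "a \<in> torus m" "b \<in> torus m"
  shows "tmul \<Xi> a b \<in> torus m"
  unfolding torus_iff
proof (intro conjI allI impI)
  fix r assume r: "r \<notin> multi_index m"
  have 0: "phase \<Xi> k (r - k) * a k * b (r - k) = 0" for k
  proof (cases "k \<in> multi_index m")
    case True
    then have "r - k \<notin> multi_index m" using multi_index_add[of k m "r - k"] r by auto
    then show ?thesis using torus_outside[OF assms(2)] by simp
  qed (simp add: torus_outside[OF assms(1)])
  show "tmul \<Xi> a b r = 0" unfolding tmul_def by (rule infsum_0) (rule 0)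
next
  fix N
  obtain C where C: "\<And>k. weight m k ^ N * cmod (b k) \<le> C" "0 \<le> C"
    using torus_bounded[OF assms(2)] by metis
  let ?g = "\<lambda>k. C * (weight m k ^ N * cmod (a k))"
  have sg: "?g summable_on UNIV"
    using torus_abs_summable[OF torus_weighted[OF assms(1), of N]] weight_pos[of m]
    by (intro summable_on_cmult_right) (simp add: norm_mult norm_power less_imp_le)
  have "weight m r ^ N * cmod (tmul \<Xi> a b r) \<le> infsum ?g UNIV" for r
  proof -
    have s: "(\<lambda>k. cmod (phase \<Xi> k (r - k) * a k * b (r - k))) summable_on UNIV"
      using tmul_abs_summable[OF assms] .
    have "cmod (tmul \<Xi> a b r) \<le> (\<Sum>\<^sub>\<infinity>k. cmod (phase \<Xi> k (r - k) * a k * b (r - k)))"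
      unfolding tmul_def by (rule norm_infsum_bound[OF s])
    then have "weight m r ^ N * cmod (tmul \<Xi> a b r) \<le>
        (\<Sum>\<^sub>\<infinity>k. weight m r ^ N * cmod (phase \<Xi> k (r - k) * a k * b (r - k)))"
      using weight_pos[of m r] by (simp add: infsum_cmult_right' mult_left_mono less_imp_le)
    also have "\<dots> \<le> infsum ?g UNIV"
    proof (rule infsum_mono[OF summable_on_cmult_right[OF s] sg])
      fix k
      have "weight m r ^ N \<le> (weight m k * weight m (r - k)) ^ N"
        using weight_add[of m k "r - k"] weight_pos[of m r] by (intro power_mono) auto
      then have "weight m r ^ N * (cmod (a k) * cmod (b (r - k))) \<le>
          (weight m k * weight m (r - k)) ^ N * (cmod (a k) * cmod (b (r - k)))"
        by (intro mult_right_mono) auto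
      also have "\<dots> = (weight m k ^ N * cmod (a k)) * (weight m (r - k) ^ N * cmod (b (r - k)))"
        by (simp add: power_mult_distrib ac_simps)
      also have "\<dots> \<le> (weight m k ^ N * cmod (a k)) * C"
        using C(1) weight_pos[of m k] by (intro mult_left_mono) auto
      finally show "weight m r ^ N * cmod (phase \<Xi> k (r - k) * a k * b (r - k)) \<le> ?g k"
        by (simp add: norm_mult norm_phase ac_simps)
    qed
    finally show ?thesis .
  qed
  then show "\<exists>C. \<forall>r. weight m r ^ N * cmod (tmul \<Xi> a b r) \<le> C" by blast
qed

text \<open>
  Both sides are double series with the terms \<open>a\<^sub>l b\<^sub>k\<^sub>-\<^sub>l c\<^sub>r\<^sub>-\<^sub>k\<close>, with phases that agree by the cocycle
  identity, summed in opposite orders. The double series converges absolutely, since \<open>a\<close> and \<open>b\<close>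
  are summable and \<open>c\<close> is bounded.
\<close>

lemma tmul_assoc:
  assumes a: "a \<in> torus m" and b: "b \<in> torus m" and c: "c \<in> torus m"
  shows "tmul \<Xi> (tmul \<Xi> a b) c = tmul \<Xi> a (tmul \<Xi> b c)"
proof
  fix r
  \<comment> \<open>The common term of both double series, with the phases of the left side.\<close>
  define F where "F l k = phase \<Xi> k (r - k) * (phase \<Xi> l (k - l) * a l * b (k - l)) * c (r - k)" for l k
  obtain C where C: "\<And>k. weight m k ^ 0 * cmod (c k) \<le> C" "0 \<le> C"
    using torus_bounded[OF c] by metis
  have "Infinite_Sum.abs_summable_on (\<lambda>(l, k). of_real C * (a l * b (k - l))) (UNIV \<times> UNIV)"
    unfolding Infinite_Sum.abs_summable_on_Sigma_iff
  proof (intro conjI ballI)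
    have b': "(\<lambda>k. cmod (b (k - l))) summable_on UNIV" for l
      using torus_abs_summable[OF b] summable_on_reindex_bij_betw[OF bij_diff_left[of l], of "\<lambda>k. cmod (b k)"]
      by simp
    then show "Infinite_Sum.abs_summable_on (\<lambda>k. (\<lambda>(l, k). of_real C * (a l * b (k - l))) (l, k)) UNIV" for l
      by (simp add: norm_mult summable_on_cmult_right)
    have "(\<Sum>\<^sub>\<infinity>k. cmod ((\<lambda>(l, k). of_real C * (a l * b (k - l))) (l, k))) =
        C * cmod (a l) * (\<Sum>\<^sub>\<infinity>k. cmod (b k))" for l
      using infsum_reindex_bij_betw[OF bij_diff_left[of l], of "\<lambda>k. cmod (b k)"] C(2)
      by (simp add: norm_mult infsum_cmult_right' mult.assoc)
    then show "Infinite_Sum.abs_summable_on (\<lambda>l. \<Sum>\<^sub>\<infinity>k. norm ((\<lambda>(l, k). of_real C * (a l * b (k - l))) (l, k))) UNIV"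
      using torus_abs_summable[OF a] C(2)
      by (simp add: abs_mult infsum_nonneg summable_on_cmult_right summable_on_cmult_left)
  qed
  then have "Infinite_Sum.abs_summable_on (\<lambda>(l, k). F l k) (UNIV \<times> UNIV)"
  proof (rule Infinite_Sum.abs_summable_on_comparison_test, clarify)
    fix l k
    show "norm (F l k) \<le> norm (of_real C * (a l * b (k - l)))"
      using mult_right_mono[OF C(1)[of "r - k"], of "cmod (a l * b (k - l))"] C(2)
      by (simp add: F_def norm_mult norm_phase ac_simps)
  qed
  then have sF: "(\<lambda>(l, k). F l k) summable_on UNIV \<times> UNIV"
    by (rule Infinite_Sum.abs_summable_summable)
  have F': "F l k = phase \<Xi> l (r - l) * a l * (phase \<Xi> (k - l) (r - l - (k - l)) * b (k - l) * c (r - l - (k - l)))" for l k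
  proof (cases "l \<in> multi_index m \<and> k - l \<in> multi_index m \<and> r - k \<in> multi_index m")
    case True
    then have "phase \<Xi> l (k - l) * phase \<Xi> (l + (k - l)) (r - k) =
        phase \<Xi> l ((k - l) + (r - k)) * phase \<Xi> (k - l) (r - k)"
      by (intro phase_cocycle) auto
    moreover have "l + (k - l) = k" "(k - l) + (r - k) = r - l" "r - l - (k - l) = r - k"
      by (auto simp: fun_eq_iff)
    ultimately show ?thesis
      unfolding F_def by (simp add: ac_simps)
  next
    case False
    \<comment> \<open>Outside the multi-indices one of the three coefficients is \<open>0\<close>.\<close>
    have "r - l - (k - l) = r - k" by (auto simp: fun_eq_iff)
    with False show ?thesis
      using torus_outside[OF a] torus_outside[OF b] torus_outside[OF c] by (auto simp: F_def)
  qed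
  have "tmul \<Xi> (tmul \<Xi> a b) c r = (\<Sum>\<^sub>\<infinity>k. \<Sum>\<^sub>\<infinity>l. F l k)"
    unfolding tmul_def F_def by (simp add: infsum_cmult_left' infsum_cmult_right')
  also have "\<dots> = (\<Sum>\<^sub>\<infinity>l. \<Sum>\<^sub>\<infinity>k. F l k)"
    by (rule infsum_swap_banach[OF sF, symmetric])
  also have "\<dots> = (\<Sum>\<^sub>\<infinity>l. \<Sum>\<^sub>\<infinity>j. phase \<Xi> l (r - l) * a l * (phase \<Xi> j (r - l - j) * b j * c (r - l - j)))"
    unfolding F'
    by (intro infsum_cong infsum_reindex_bij_betw[OF bij_diff_left])
  also have "\<dots> = tmul \<Xi> a (tmul \<Xi> b c) r"
    unfolding tmul_def by (simp add: infsum_cmult_right')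
  finally show "tmul \<Xi> (tmul \<Xi> a b) c r = tmul \<Xi> a (tmul \<Xi> b c) r" .
qed

lemma tmul_add_left:
  assumes "a \<in> torus m" "a' \<in> torus m" "b \<in> torus m"
  shows "tmul \<Xi> (a + a') b = tmul \<Xi> a b + tmul \<Xi> a' b"
proof
  fix r
  show "tmul \<Xi> (a + a') b r = (tmul \<Xi> a b + tmul \<Xi> a' b) r"
    using infsum_add[OF tmul_summable[OF assms(1,3)] tmul_summable[OF assms(2,3)], of \<Xi> r \<Xi> r]
    by (simp add: tmul_def algebra_simps)
qed

lemma tmul_add_right:
  assumes "a \<in> torus m" "b \<in> torus m" "b' \<in> torus m"
  shows "tmul \<Xi> a (b + b') = tmul \<Xi> a b + tmul \<Xi> a b'"
proof
  fix r
  show "tmul \<Xi> a (b + b') r = (tmul \<Xi> a b + tmul \<Xi> a b') r"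
    using infsum_add[OF tmul_summable[OF assms(1,2)] tmul_summable[OF assms(1,3)], of \<Xi> r \<Xi> r]
    by (simp add: tmul_def algebra_simps)
qed

lemma tmul_scale_left: "tmul \<Xi> (tscale c a) b = tscale c (tmul \<Xi> a b)"
  by (simp add: fun_eq_iff tmul_def tscale_def infsum_cmult_right'[symmetric] ac_simps)

lemma tmul_scale_right: "tmul \<Xi> a (tscale c b) = tscale c (tmul \<Xi> a b)"
  by (simp add: fun_eq_iff tmul_def tscale_def infsum_cmult_right'[symmetric] ac_simps)

lemma tmul_zero_left [simp]: "tmul \<Xi> 0 b = 0"
  by (simp add: fun_eq_iff tmul_def)

lemma tmul_zero_right [simp]: "tmul \<Xi> a 0 = 0"
  by (simp add: fun_eq_iff tmul_def)

lemma infsum_single_term: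
  fixes f :: "'a \<Rightarrow> complex"
  assumes "\<And>y. y \<noteq> x \<Longrightarrow> f y = 0"
  shows "(\<Sum>\<^sub>\<infinity>y. f y) = f x"
  using infsum_cong_neutral[of UNIV "{x}" f f] assms by simp

lemma tmul_tone_left [simp]: "tmul \<Xi> tone a = a"
proof
  fix r
  have "tmul \<Xi> tone a r = phase \<Xi> 0 (r - 0) * tone 0 * a (r - 0)"
    unfolding tmul_def by (rule infsum_single_term) (auto simp: tone_def qmon_def fun_eq_iff)
  then show "tmul \<Xi> tone a r = a r" by (simp add: tone_def qmon_def fun_eq_iff)
qed

lemma tmul_tone_right [simp]: "tmul \<Xi> a tone = a"
proof
  fix r
  have "tmul \<Xi> a tone r = phase \<Xi> r (r - r) * a r * tone (r - r)"
    unfolding tmul_def by (rule infsum_single_term) (auto simp: tone_def qmon_def fun_eq_iff)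
  then show "tmul \<Xi> a tone r = a r" by (simp add: tone_def qmon_def fun_eq_iff)
qed

text \<open>
  The factor \<open>r\<^sub>j\<close> in front of the coefficient of \<open>u^r\<close> is \<open>k\<^sub>j + (r - k)\<^sub>j\<close> in each term of the
  convolution.
\<close>

lemma delta_tmul:
  assumes "a \<in> torus m" "b \<in> torus m"
  shows "delta j (tmul \<Xi> a b) = tmul \<Xi> (delta j a) b + tmul \<Xi> a (delta j b)"
proof
  fix r
  have "(tmul \<Xi> (delta j a) b + tmul \<Xi> a (delta j b)) r =
      (\<Sum>\<^sub>\<infinity>k. phase \<Xi> k (r - k) * delta j a k * b (r - k) + phase \<Xi> k (r - k) * a k * delta j b (r - k))"
    unfolding tmul_def plus_fun_apply
    using infsum_add[OF tmul_summable[OF torus_delta[OF assms(1)] assms(2)]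
        tmul_summable[OF assms(1) torus_delta[OF assms(2)]], of \<Xi> r j \<Xi> r j] by simp
  also have "\<dots> = delta j (tmul \<Xi> a b) r"
    unfolding tmul_def delta_def
    by (simp add: infsum_cmult_right'[symmetric] algebra_simps)
  finally show "delta j (tmul \<Xi> a b) r = (tmul \<Xi> (delta j a) b + tmul \<Xi> a (delta j b)) r" ..
qed

lemma phase_disjoint:
  assumes "\<And>i j. j < i \<Longrightarrow> k i = 0 \<or> l j = 0"
  shows "phase \<Xi> k l = 1"
proof -
  have "{(i, j). j < i \<and> k i \<noteq> 0 \<and> l j \<noteq> 0} = {}" using assms by blast
  then show ?thesis unfolding phase_def by (simp only: sum.empty mult_zero_right cis_zero)
qed

lemma tmul_qmon: "tmul \<Xi> (qmon k) (qmon l) = tscale (phase \<Xi> k l) (qmon (k + l))"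
proof
  fix r
  have "tmul \<Xi> (qmon k) (qmon l) r = phase \<Xi> k (r - k) * qmon k k * qmon l (r - k)"
    unfolding tmul_def by (rule infsum_single_term) (simp add: qmon_def)
  also have "\<dots> = tscale (phase \<Xi> k l) (qmon (k + l)) r"
  proof (cases "r = k + l")
    case False
    then have "r - k \<noteq> l" by (metis diff_add_cancel add.commute)
    with False show ?thesis by (simp add: qmon_def tscale_def)
  qed (simp add: qmon_def tscale_def)
  finally show "tmul \<Xi> (qmon k) (qmon l) r = tscale (phase \<Xi> k l) (qmon (k + l)) r" .
qed

text \<open>
  Ordering powers of a single generator creates no phase, so \<open>u\<^sub>j\<^sup>*\<close> is the monomial \<open>u\<^sub>j\<^sup>-\<^sup>1\<close> and the
  product is \<open>1\<close>.
\<close>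

lemma tmul_star_gen: "tmul \<Xi> (tstar \<Xi> (gen j)) (gen j) = tone"
proof -
  define e where "e = (\<lambda>i. if i = j then 1 else 0 :: int)"
  have gen: "gen j = qmon e" by (simp add: gen_def e_def)
  have "tstar \<Xi> (gen j) = qmon (- e)"
  proof
    fix r
    show "tstar \<Xi> (gen j) r = qmon (- e) r"
    proof (cases "r = - e")
      case True
      then have "phase \<Xi> r r = 1" by (intro phase_disjoint) (auto simp: e_def)
      with True show ?thesis by (simp add: tstar_def gen qmon_def)
    next
      case False
      then have "- r \<noteq> e" by (metis minus_minus)
      with False show ?thesis by (simp add: tstar_def gen qmon_def)
    qed
  qed
  moreover have "phase \<Xi> (- e) e = 1" by (intro phase_disjoint) (auto simp: e_def)
  ultimately have "tmul \<Xi> (tstar \<Xi> (gen j)) (gen j) = tscale 1 (qmon (- e + e))"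
    by (simp only: gen tmul_qmon)
  then show ?thesis by (simp add: tscale_def tone_def zero_fun_def)
qed

section \<open>The differential and the Hodge operator\<close>

lemma sum_apply: "(\<Sum>i\<in>A. f i) x = (\<Sum>i\<in>A. f i x)"
  for f :: "'i \<Rightarrow> 'a \<Rightarrow> 'b::comm_monoid_add"
  by (induction A rule: infinite_finite_induct) simp_all

lemma tscale_zero [simp]: "tscale c 0 = 0"
  by (simp add: tscale_def fun_eq_iff)

lemma tscale_zero_left [simp]: "tscale 0 a = 0"
  by (simp add: tscale_def fun_eq_iff)

lemma tscale_one [simp]: "tscale 1 a = a"
  by (simp add: tscale_def)

lemma tscale_tscale [simp]: "tscale c (tscale d a) = tscale (c * d) a"
  by (simp add: tscale_def mult.assoc)

lemma tscale_add: "tscale c (a + b) = tscale c a + tscale c b"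
  by (simp add: tscale_def fun_eq_iff distrib_left)

lemma tscale_add_left: "tscale (c + d) a = tscale c a + tscale d a"
  by (simp add: tscale_def fun_eq_iff distrib_right)

lemma tscale_sum: "tscale c (\<Sum>i\<in>A. f i) = (\<Sum>i\<in>A. tscale c (f i))"
  by (rule ext) (simp add: tscale_def sum_apply sum_distrib_left)

lemma delta_zero [simp]: "delta j 0 = 0"
  by (simp add: delta_def fun_eq_iff)

lemma delta_add: "delta j (a + b) = delta j a + delta j b"
  by (simp add: delta_def fun_eq_iff distrib_left)

lemma delta_tscale: "delta j (tscale c a) = tscale c (delta j a)"
  by (simp add: delta_def tscale_def fun_eq_iff)

lemma delta_tone [simp]: "delta j tone = 0"
  by (simp add: delta_def tone_def qmon_def fun_eq_iff)

lemma torus_sum: "(\<And>i. i \<in> A \<Longrightarrow> f i \<in> torus m) \<Longrightarrow> (\<Sum>i\<in>A. f i) \<in> torus m"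
  by (induction A rule: infinite_finite_induct) (simp_all add: torus_add torus_zero)

lemma tmul_sum_right:
  assumes "a \<in> torus m" "\<And>i. i \<in> A \<Longrightarrow> f i \<in> torus m"
  shows "tmul \<Xi> a (\<Sum>i\<in>A. f i) = (\<Sum>i\<in>A. tmul \<Xi> a (f i))"
  using assms(2)
  by (induction A rule: infinite_finite_induct) (simp_all add: tmul_add_right[OF assms(1)] torus_sum)

lemma OmegaD:
  assumes "w \<in> Omega m"
  shows "w K \<in> torus m" "\<not> K \<subseteq> {1..m} \<Longrightarrow> w K = 0" "infinite K \<Longrightarrow> w K = 0"
  using assms finite_subset[of K "{1..m}"] by (auto simp: Omega_def)

lemma OmegaI: "(\<And>K. w K \<in> torus m) \<Longrightarrow> (\<And>K. \<not> K \<subseteq> {1..m} \<Longrightarrow> w K = 0) \<Longrightarrow> w \<in> Omega m"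
  by (simp add: Omega_def)

lemma Omega_add: "v \<in> Omega m \<Longrightarrow> w \<in> Omega m \<Longrightarrow> v + w \<in> Omega m"
  by (auto simp: Omega_def torus_add)

lemma Omega_zero: "0 \<in> Omega m"
  by (auto simp: Omega_def torus_zero)

lemma Omega_scale: "w \<in> Omega m \<Longrightarrow> fscale c w \<in> Omega m"
  by (auto simp: Omega_def fscale_def torus_scale)

lemma emb_in_Omega: "x \<in> torus m \<Longrightarrow> emb x \<in> Omega m"
  by (auto simp: Omega_def emb_def torus_zero)

lemma wsgn_empty [simp]: "wsgn {} J = 1" "wsgn I {} = 1"
  by (simp_all add: wsgn_def)

lemma wsgn_square: "wsgn I J * wsgn I J = 1"
  by (simp add: wsgn_def power_add[symmetric] mult_2[symmetric])

text \<open>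
  At an infinite set \<open>K\<close> the defining sum over all subsets of \<open>K\<close> is \<open>0\<close> by convention. Forms of
  the calculus vanish there anyway.
\<close>

lemma fmul_emb_apply: "fmul \<Xi> (emb x) w K = (if finite K then tmul \<Xi> x (w K) else 0)"
proof (cases "finite K")
  case True
  have "fmul \<Xi> (emb x) w K = (\<Sum>I\<in>Pow K. if I = {} then tmul \<Xi> x (w K) else 0)"
    unfolding fmul_def by (intro sum.cong) (auto simp: emb_def)
  with True show ?thesis by simp
qed (simp add: fmul_def)

lemma fmul_emb:
  assumes "w \<in> Omega m"
  shows "fmul \<Xi> (emb x) w = (\<lambda>K. tmul \<Xi> x (w K))"
  by (auto simp: fmul_emb_apply OmegaD[OF assms])

lemma fmul_emb_in_Omega:
  assumes "x \<in> torus m" "w \<in> Omega m"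
  shows "fmul \<Xi> (emb x) w \<in> Omega m"
  unfolding fmul_emb[OF assms(2)]
proof (rule OmegaI)
  show "tmul \<Xi> x (w K) = 0" if "\<not> K \<subseteq> {1..m}" for K
    unfolding OmegaD(2)[OF assms(2) that] by (rule tmul_zero_right)
qed (rule tmul_closed[OF assms(1) OmegaD(1)[OF assms(2)]])

text \<open>
  Associativity of the product, applied to each coefficient, makes the forms a left module.
\<close>

lemma fmul_emb_fmul_emb:
  assumes "x \<in> torus m" "y \<in> torus m" "w \<in> Omega m"
  shows "fmul \<Xi> (emb (tmul \<Xi> x y)) w = fmul \<Xi> (emb x) (fmul \<Xi> (emb y) w)"
proof -
  have "fmul \<Xi> (emb x) (fmul \<Xi> (emb y) w) = (\<lambda>K. tmul \<Xi> x (fmul \<Xi> (emb y) w K))"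
    by (rule fmul_emb[OF fmul_emb_in_Omega[OF assms(2,3)]])
  then show ?thesis
    by (simp only: fmul_emb[OF assms(3)] tmul_assoc[OF assms(1,2) OmegaD(1)[OF assms(3)]])
qed

lemma fmul_emb_add:
  assumes "x \<in> torus m" "v \<in> Omega m" "w \<in> Omega m"
  shows "fmul \<Xi> (emb x) (v + w) = fmul \<Xi> (emb x) v + fmul \<Xi> (emb x) w"
  using assms by (auto simp: fun_eq_iff fmul_emb_apply tmul_add_right[OF assms(1)] OmegaD)

lemma fmul_emb_add_left:
  assumes "x \<in> torus m" "y \<in> torus m" "w \<in> Omega m"
  shows "fmul \<Xi> (emb (x + y)) w = fmul \<Xi> (emb x) w + fmul \<Xi> (emb y) w"
  using assms by (auto simp: fun_eq_iff fmul_emb_apply tmul_add_left[OF assms(1,2)] OmegaD)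

lemma fmul_dU_apply:
  assumes "finite K"
  shows "fmul \<Xi> v (dU I) K = (if I \<subseteq> K then tscale (wsgn (K - I) I) (v (K - I)) else 0)"
proof -
  have "fmul \<Xi> v (dU I) K =
      (\<Sum>L\<in>Pow K. if L = K - I \<and> I \<subseteq> K then tscale (wsgn (K - I) I) (v (K - I)) else 0)"
    unfolding fmul_def
  proof (intro sum.cong refl)
    fix L assume "L \<in> Pow K"
    then have "K - L = I \<longleftrightarrow> L = K - I \<and> I \<subseteq> K" by auto
    then show "tscale (wsgn L (K - L)) (tmul \<Xi> (v L) (dU I (K - L))) =
        (if L = K - I \<and> I \<subseteq> K then tscale (wsgn (K - I) I) (v (K - I)) else 0)"
      by (auto simp: dU_def double_diff)
  qed
  also have "\<dots> = (if I \<subseteq> K then tscale (wsgn (K - I) I) (v (K - I)) else 0)"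
    using assms by (cases "I \<subseteq> K") simp_all
  finally show ?thesis .
qed

lemma fmul_infinite: "infinite K \<Longrightarrow> fmul \<Xi> v w K = 0"
  by (simp add: fmul_def)

lemma fmul_zero_left [simp]: "fmul \<Xi> 0 w = 0"
  by (simp add: fmul_def fun_eq_iff tscale_def)

lemma fmul_zero_right [simp]: "fmul \<Xi> v 0 = 0"
  by (simp add: fmul_def fun_eq_iff tscale_def)

lemma d0_apply: "d0 m \<Xi> x K = (\<Sum>j=1..m. if K = {j} then tscale \<i> (delta j x) else 0)"
proof -
  have "tscale \<i> (fmul \<Xi> (emb y) (dU {j}) K) = (if K = {j} then tscale \<i> y else 0)" for y j
    by (cases "K = {j}") (simp_all add: fmul_emb_apply dU_def)
  then show ?thesis
    by (simp only: d0_def fscale_def sum_apply tscale_sum)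
qed

lemma d0_singleton: "j \<in> {1..m} \<Longrightarrow> d0 m \<Xi> x {j} = tscale \<i> (delta j x)"
  by (simp add: d0_apply)

lemma d0_eq_0: "(\<And>j. j \<in> {1..m} \<Longrightarrow> K \<noteq> {j}) \<Longrightarrow> d0 m \<Xi> x K = 0"
  by (auto simp: d0_apply intro!: sum.neutral)

text \<open>
  The coefficients of \<open>dw\<close> are \<open>(dw)\<^sub>K = \<Sum>\<^sub>j\<^sub>\<in>\<^sub>K \<plusminus> i \<delta>\<^sub>j w\<^sub>K\<^sub>-\<^sub>{\<^sub>j\<^sub>}\<close>: a summand \<open>d(w\<^sub>I) d\<bbbU>\<^sub>I\<close> contributes to \<open>K\<close>
  only if \<open>K\<close> arises from \<open>I\<close> by adding one index. The other properties of \<open>d\<close> are read off from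
  this formula.
\<close>

lemma ext_d_apply:
  "ext_d m \<Xi> w K = (if K \<subseteq> {1..m}
     then (\<Sum>j\<in>K. tscale (\<i> * wsgn {j} (K - {j})) (delta j (w (K - {j})))) else 0)"
proof (cases "K \<subseteq> {1..m}")
  case True
  then have fin: "finite K" by (rule finite_subset) simp
  let ?g = "\<lambda>I. if I \<subseteq> K then tscale (wsgn (K - I) I) (d0 m \<Xi> (w I) (K - I)) else 0"
  have inj: "inj_on (\<lambda>j. K - {j}) K" by (rule inj_onI) auto
  have "ext_d m \<Xi> w K = sum ?g (Pow {1..m})"
    by (simp add: ext_d_def sum_apply fmul_dU_apply[OF fin])
  \<comment> \<open>A summand survives only if \<open>K - I\<close> is a singleton \<open>{j}\<close>, which means that \<open>I = K - {j}\<close>.\<close>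
  also have "\<dots> = sum ?g ((\<lambda>j. K - {j}) ` K)"
  proof (rule sum.mono_neutral_right)
    show "\<forall>I\<in>Pow {1..m} - (\<lambda>j. K - {j}) ` K. ?g I = 0"
    proof
      fix I assume I: "I \<in> Pow {1..m} - (\<lambda>j. K - {j}) ` K"
      have "K - I \<noteq> {j}" if "I \<subseteq> K" for j
      proof
        assume "K - I = {j}"
        with that have "j \<in> K" "I = K - {j}" by auto
        with I show False by blast
      qed
      then show "?g I = 0" by (simp add: d0_eq_0)
    qed
  qed (use True in auto)
  also have "\<dots> = (\<Sum>j\<in>K. ?g (K - {j}))"
    by (simp add: sum.reindex[OF inj])
  also have "\<dots> = (\<Sum>j\<in>K. tscale (\<i> * wsgn {j} (K - {j})) (delta j (w (K - {j}))))"
  proof (intro sum.cong refl)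
    fix j assume j: "j \<in> K"
    then have "K - (K - {j}) = {j}" by auto
    with j True show "?g (K - {j}) = tscale (\<i> * wsgn {j} (K - {j})) (delta j (w (K - {j})))"
      by (auto simp: d0_singleton mult.commute)
  qed
  finally show ?thesis using True by simp
next
  case False
  have "fmul \<Xi> (d0 m \<Xi> (w I)) (dU I) K = 0" if I: "I \<subseteq> {1..m}" for I
  proof (cases "finite K")
    case True
    have "d0 m \<Xi> (w I) (K - I) = 0" if "I \<subseteq> K"
    proof (rule d0_eq_0)
      fix j assume "j \<in> {1..m}"
      with I False \<open>I \<subseteq> K\<close> show "K - I \<noteq> {j}" by auto
    qed
    with True show ?thesis by (simp add: fmul_dU_apply)
  qed (rule fmul_infinite)
  with False show ?thesis by (simp add: ext_d_def sum_apply)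
qed

lemma ext_d_in_Omega:
  assumes "w \<in> Omega m"
  shows "ext_d m \<Xi> w \<in> Omega m"
  by (rule OmegaI) (auto simp: ext_d_apply intro!: torus_sum torus_scale torus_delta OmegaD[OF assms] torus_zero)

lemma ext_d_add: "ext_d m \<Xi> (v + w) = ext_d m \<Xi> v + ext_d m \<Xi> w"
  by (auto simp: fun_eq_iff ext_d_apply delta_add tscale_add sum.distrib)

lemma ext_d_scale: "ext_d m \<Xi> (fscale c w) = fscale c (ext_d m \<Xi> w)"
  by (auto simp: fun_eq_iff ext_d_apply fscale_def delta_tscale tscale_sum ac_simps)

lemma ext_d_zero [simp]: "ext_d m \<Xi> 0 = 0"
  by (auto simp: fun_eq_iff ext_d_apply)

text \<open>
  Curvature and covariant derivative are formed with the differential of the total space, the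
  Yang--Mills equation with that of the base. They agree on base forms because \<open>\<delta>\<^sub>n\<^sub>+\<^sub>1\<close> is zero on
  elements that do not contain \<open>u\<^sub>n\<^sub>+\<^sub>1\<close>.
\<close>

lemma ext_d_Suc_base:
  assumes "w \<in> Omega n"
  shows "ext_d (Suc n) \<Xi> w = ext_d n \<Xi> w"
proof
  fix K
  have top: "delta (Suc n) a = 0" if "a \<in> torus n" for a
  proof
    fix r
    show "delta (Suc n) a r = 0 r"
      using torus_outside[OF that, of r]
      by (cases "r \<in> multi_index n") (simp_all add: delta_def multi_index_def)
  qed
  have 0: "delta j (w (K - {j})) = 0" if "Suc n \<in> K" for j
  proof (cases "j = Suc n")
    case False
    with that have "\<not> K - {j} \<subseteq> {1..n}" by auto
    then show ?thesis by (simp add: OmegaD(2)[OF assms])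
  qed (simp add: top OmegaD(1)[OF assms])
  show "ext_d (Suc n) \<Xi> w K = ext_d n \<Xi> w K"
  proof (cases "Suc n \<in> K")
    case True
    then show ?thesis by (auto simp: ext_d_apply 0)
  next
    case False
    then have "K \<subseteq> {1..Suc n} \<longleftrightarrow> K \<subseteq> {1..n}" by (auto simp: le_Suc_eq)
    then show ?thesis by (simp add: ext_d_apply)
  qed
qed

lemma ext_d_emb: "ext_d m \<Xi> (emb x) K = (\<Sum>j=1..m. if K = {j} then tscale \<i> (delta j x) else 0)"
proof -
  have "ext_d m \<Xi> (emb x) K = d0 m \<Xi> x K"
  proof (cases "\<exists>j\<in>{1..m}. K = {j}")
    case True
    then show ?thesis by (auto simp: ext_d_apply emb_def d0_singleton)
  next
    case False
    have "K \<subseteq> {1..m} \<Longrightarrow> j \<in> K \<Longrightarrow> emb x (K - {j}) = 0" for j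
      using False by (auto simp: emb_def)
    then have "ext_d m \<Xi> (emb x) K = 0" by (simp add: ext_d_apply)
    moreover have "d0 m \<Xi> x K = 0" using False by (intro d0_eq_0) auto
    ultimately show ?thesis by simp
  qed
  then show ?thesis by (simp add: d0_apply)
qed

text \<open>
  The form \<open>dx\<close> has coefficients at singletons only, so its product with \<open>w\<close> has the same shape as
  the coefficient formula of \<open>d\<close>, and the claim reduces to the product rule for the \<open>\<delta>\<^sub>j\<close>.
\<close>

lemma ext_d_Leibniz:
  assumes "x \<in> torus m" "w \<in> Omega m"
  shows "ext_d m \<Xi> (fmul \<Xi> (emb x) w) =
    fmul \<Xi> (ext_d m \<Xi> (emb x)) w + fmul \<Xi> (emb x) (ext_d m \<Xi> w)"
proof
  fix K
  show "ext_d m \<Xi> (fmul \<Xi> (emb x) w) K =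
    (fmul \<Xi> (ext_d m \<Xi> (emb x)) w + fmul \<Xi> (emb x) (ext_d m \<Xi> w)) K"
  proof (cases "K \<subseteq> {1..m}")
    case True
    then have fin: "finite K" by (rule finite_subset) simp
    let ?dx = "ext_d m \<Xi> (emb x)"
    let ?s = "\<lambda>j. \<i> * wsgn {j} (K - {j})"
    have dx: "?dx I = 0" if "I \<in> Pow K - (\<lambda>j. {j}) ` K" for I
      unfolding ext_d_emb using that by (intro sum.neutral) auto
    have "fmul \<Xi> ?dx w K = (\<Sum>I\<in>(\<lambda>j. {j}) ` K. tscale (wsgn I (K - I)) (tmul \<Xi> (?dx I) (w (K - I))))"
      unfolding fmul_def by (rule sum.mono_neutral_right) (use fin dx in auto)
    also have "\<dots> = (\<Sum>j\<in>K. tscale (wsgn {j} (K - {j})) (tmul \<Xi> (?dx {j}) (w (K - {j}))))"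
      by (simp add: sum.reindex inj_on_def)
    also have "\<dots> = (\<Sum>j\<in>K. tscale (?s j) (tmul \<Xi> (delta j x) (w (K - {j}))))"
    proof (intro sum.cong refl)
      fix j assume "j \<in> K"
      with True have "j \<in> {1..m}" by auto
      then have "?dx {j} = tscale \<i> (delta j x)" by (simp add: ext_d_emb)
      then show "tscale (wsgn {j} (K - {j})) (tmul \<Xi> (?dx {j}) (w (K - {j}))) =
          tscale (?s j) (tmul \<Xi> (delta j x) (w (K - {j})))"
        by (simp add: tmul_scale_left mult.commute)
    qed
    finally have 1: "fmul \<Xi> ?dx w K = (\<Sum>j\<in>K. tscale (?s j) (tmul \<Xi> (delta j x) (w (K - {j}))))" .
    have 2: "fmul \<Xi> (emb x) (ext_d m \<Xi> w) K = (\<Sum>j\<in>K. tscale (?s j) (tmul \<Xi> x (delta j (w (K - {j})))))"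
      using fin True assms
      by (simp add: fmul_emb_apply ext_d_apply tmul_sum_right[where m=m] torus_scale torus_delta OmegaD tmul_scale_right)
    have "ext_d m \<Xi> (fmul \<Xi> (emb x) w) K =
        (\<Sum>j\<in>K. tscale (?s j) (tmul \<Xi> (delta j x) (w (K - {j})) + tmul \<Xi> x (delta j (w (K - {j})))))"
      using True assms by (simp add: ext_d_apply fmul_emb delta_tmul[where m=m] OmegaD)
    then show ?thesis by (simp add: 1 2 tscale_add sum.distrib)
  next
    case False
    have "fmul \<Xi> (ext_d m \<Xi> (emb x)) w K = 0"
      unfolding fmul_def
    proof (intro sum.neutral ballI)
      fix I assume "I \<in> Pow K"
      with False have "\<not> I \<subseteq> {1..m} \<or> \<not> K - I \<subseteq> {1..m}" by auto
      then show "tscale (wsgn I (K - I)) (tmul \<Xi> (ext_d m \<Xi> (emb x) I) (w (K - I))) = 0"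
        using OmegaD(2)[OF assms(2)] by (auto simp: ext_d_apply)
    qed
    with False show ?thesis
      by (simp add: ext_d_apply fmul_emb_apply)
  qed
qed

lemma fmul_in_Omega:
  assumes "v \<in> Omega m" "w \<in> Omega m"
  shows "fmul \<Xi> v w \<in> Omega m"
proof (rule OmegaI)
  show "fmul \<Xi> v w K \<in> torus m" for K
    unfolding fmul_def by (intro torus_sum torus_scale tmul_closed OmegaD(1) assms)
  show "fmul \<Xi> v w K = 0" if "\<not> K \<subseteq> {1..m}" for K
    unfolding fmul_def
  proof (intro sum.neutral ballI)
    fix I assume "I \<in> Pow K"
    with that have "\<not> I \<subseteq> {1..m} \<or> \<not> K - I \<subseteq> {1..m}" by auto
    then have "v I = 0 \<or> w (K - I) = 0"
      using OmegaD(2)[OF assms(1), of I] OmegaD(2)[OF assms(2), of "K - I"] by metis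
    then show "tscale (wsgn I (K - I)) (tmul \<Xi> (v I) (w (K - I))) = 0" by auto
  qed
qed

lemma fmul_add_left:
  assumes "u \<in> Omega m" "v \<in> Omega m" "w \<in> Omega m"
  shows "fmul \<Xi> (u + v) w = fmul \<Xi> u w + fmul \<Xi> v w"
proof
  fix K
  have "fmul \<Xi> (u + v) w K = (\<Sum>I\<in>Pow K. tscale (wsgn I (K - I)) (tmul \<Xi> (u I + v I) (w (K - I))))"
    by (simp only: fmul_def plus_fun_apply[of u v])
  also have "\<dots> = fmul \<Xi> u w K + fmul \<Xi> v w K"
    using assms by (simp add: fmul_def sum.distrib[symmetric] tmul_add_left[where m=m] OmegaD tscale_add)
  finally show "fmul \<Xi> (u + v) w K = (fmul \<Xi> u w + fmul \<Xi> v w) K" by simp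
qed

lemma fmul_emb_assoc:
  assumes "x \<in> torus m" "v \<in> Omega m" "w \<in> Omega m"
  shows "fmul \<Xi> (fmul \<Xi> (emb x) v) w = fmul \<Xi> (emb x) (fmul \<Xi> v w)"
proof
  fix K
  have "fmul \<Xi> (emb x) (fmul \<Xi> v w) K = tmul \<Xi> x (fmul \<Xi> v w K)"
    using fmul_emb[OF fmul_in_Omega[OF assms(2,3)]] by metis
  also have "\<dots> = fmul \<Xi> (fmul \<Xi> (emb x) v) w K"
    using assms unfolding fmul_def[of \<Xi> v] fmul_def[of \<Xi> "fmul \<Xi> (emb x) v"]
    by (simp add: tmul_sum_right[where m=m] torus_scale tmul_closed OmegaD fmul_emb
        tmul_scale_right tmul_assoc[where m=m])
  finally show "fmul \<Xi> (fmul \<Xi> (emb x) v) w K = fmul \<Xi> (emb x) (fmul \<Xi> v w) K" ..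
qed

lemma hodge_in_Omega:
  assumes "w \<in> Omega n"
  shows "hodge n w \<in> Omega n"
  by (rule OmegaI) (auto simp: hodge_def torus_zero intro!: torus_scale OmegaD(1)[OF assms])

lemma hodge_add: "hodge n (v + w) = hodge n v + hodge n w"
  by (auto simp: hodge_def fun_eq_iff tscale_add)

text \<open>
  The Hodge operator permutes the coefficients up to signs, and this commutes with multiplication
  by an algebra element from the left.
\<close>

lemma hodge_fmul_emb:
  assumes "w \<in> Omega n"
  shows "hodge n (fmul \<Xi> (emb x) w) = fmul \<Xi> (emb x) (hodge n w)"
  unfolding fmul_emb[OF assms] fmul_emb[OF hodge_in_Omega[OF assms]]
  by (auto simp: hodge_def tmul_scale_right)

text \<open>
  Taking complements twice is the identity, and both passages carry the same sign, which squares
  to \<open>1\<close>.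
\<close>

lemma bij_betw_hodge: "bij_betw (hodge n) (Omega n) (Omega n)"
proof -
  let ?c = "\<lambda>J. {1..n} - J :: nat set"
  define h where "h w = (\<lambda>J. if J \<subseteq> {1..n} then tscale (wsgn J (?c J)) (w (?c J)) else 0)" for w :: form
  have cc: "?c (?c J) = J" if "J \<subseteq> {1..n}" for J using that by auto
  show ?thesis
  proof (rule bij_betw_byWitness[where f' = h])
    show "\<forall>w\<in>Omega n. h (hodge n w) = w"
    proof (intro ballI ext[of "h _"])
      fix w J assume "w \<in> Omega n"
      then show "h (hodge n w) J = w J"
        using cc[of J] OmegaD(2)[of w n J]
        by (cases "J \<subseteq> {1..n}") (simp_all add: h_def hodge_def wsgn_square)
    qed
    show "\<forall>w\<in>Omega n. hodge n (h w) = w"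
    proof (intro ballI ext[of "hodge n _"])
      fix w J assume "w \<in> Omega n"
      then show "hodge n (h w) J = w J"
        using cc[of J] OmegaD(2)[of w n J]
        by (cases "J \<subseteq> {1..n}") (simp_all add: h_def hodge_def wsgn_square)
    qed
    show "h ` Omega n \<subseteq> Omega n"
    proof (intro image_subsetI OmegaI)
      fix w K assume w: "w \<in> Omega n"
      show "h w K \<in> torus n"
        by (simp add: h_def torus_zero torus_scale OmegaD(1)[OF w])
      show "\<not> K \<subseteq> {1..n} \<Longrightarrow> h w K = 0"
        by (simp only: h_def if_False)
    qed
  qed (auto intro: hodge_in_Omega)
qed

lemma hodge_inv_in_Omega: "w \<in> Omega n \<Longrightarrow> hodge_inv n w \<in> Omega n"
  using bij_betw_hodge[of n] unfolding hodge_inv_def by (metis bij_betw_imp_surj_on inv_into_into)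

lemma hodge_hodge_inv: "w \<in> Omega n \<Longrightarrow> hodge n (hodge_inv n w) = w"
  using bij_betw_hodge[of n] unfolding hodge_inv_def by (simp add: bij_betw_inv_into_right)

lemma hodge_inv_hodge: "w \<in> Omega n \<Longrightarrow> hodge_inv n (hodge n w) = w"
  using bij_betw_hodge[of n] unfolding hodge_inv_def by (simp add: bij_betw_inv_into_left)

lemma hodge_inv_add:
  assumes "v \<in> Omega n" "w \<in> Omega n"
  shows "hodge_inv n (v + w) = hodge_inv n v + hodge_inv n w"
proof -
  have "v + w = hodge n (hodge_inv n v + hodge_inv n w)"
    by (simp add: hodge_add hodge_hodge_inv assms)
  then show ?thesis
    by (simp add: hodge_inv_hodge Omega_add hodge_inv_in_Omega assms)
qed

lemma hodge_inv_fmul_emb: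
  assumes "x \<in> torus n" "w \<in> Omega n"
  shows "hodge_inv n (fmul \<Xi> (emb x) w) = fmul \<Xi> (emb x) (hodge_inv n w)"
proof -
  have "fmul \<Xi> (emb x) w = hodge n (fmul \<Xi> (emb x) (hodge_inv n w))"
    by (simp add: hodge_fmul_emb hodge_inv_in_Omega hodge_hodge_inv assms)
  then show ?thesis
    by (simp add: hodge_inv_hodge fmul_emb_in_Omega hodge_inv_in_Omega assms)
qed

section \<open>Coinvariant forms and intertwiners\<close>

text \<open>
  At indices with \<open>r (n + 1) = 0\<close> the weights of both tori agree, so their decay conditions coincide.
\<close>

lemma torus_Suc_iff:
  "x \<in> torus n \<longleftrightarrow> x \<in> torus (Suc n) \<and> (\<forall>r. r (Suc n) \<noteq> 0 \<longrightarrow> x r = 0)"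
proof -
  have idx: "r \<in> multi_index n \<longleftrightarrow> r \<in> multi_index (Suc n) \<and> r (Suc n) = 0" for r
  proof
    assume "r \<in> multi_index (Suc n) \<and> r (Suc n) = 0"
    then show "r \<in> multi_index n"
      unfolding multi_index_def by (auto simp: le_Suc_eq)
  qed (auto simp: multi_index_def)
  have weight: "weight (Suc n) r = weight n r" if "r (Suc n) = 0" for r
    using that by (simp add: weight_def)
  show ?thesis
  proof (cases "\<forall>r. r (Suc n) \<noteq> 0 \<longrightarrow> x r = 0")
    case True
    have "weight (Suc n) r ^ N * cmod (x r) = weight n r ^ N * cmod (x r)" for r N
      using True weight[of r] by (cases "r (Suc n) = 0") simp_all
    moreover have "(\<forall>r. r \<notin> multi_index n \<longrightarrow> x r = 0) \<longleftrightarrow> (\<forall>r. r \<notin> multi_index (Suc n) \<longrightarrow> x r = 0)"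
      using True idx by blast
    ultimately have "x \<in> torus n \<longleftrightarrow> x \<in> torus (Suc n)" by (simp only: torus_iff)
    with True show ?thesis by blast
  next
    case False
    then show ?thesis unfolding torus_iff using idx by blast
  qed
qed

lemma Omega_Suc_base: "w \<in> Omega n \<Longrightarrow> w \<in> Omega (Suc n)"
proof (rule OmegaI)
  fix K assume w: "w \<in> Omega n"
  show "w K \<in> torus (Suc n)"
    using torus_Suc_iff[THEN iffD1, OF OmegaD(1)[OF w]] by (rule conjunct1)
  assume "\<not> K \<subseteq> {1..Suc n}"
  then have "\<not> K \<subseteq> {1..n}" by auto
  then show "w K = 0" by (rule OmegaD(2)[OF w])
qed

lemma coact_base: "x \<in> torus n \<Longrightarrow> coact n x = (\<lambda>k. if k = 0 then x else 0)"
  using torus_Suc_iff[THEN iffD1, THEN conjunct2, of x n] by (auto simp: coact_def fun_eq_iff)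

lemma coact_zero [simp]: "coact n 0 k = 0"
  by (auto simp: coact_def)

lemma emb_zero [simp]: "emb 0 = 0"
  by (auto simp: emb_def)

lemma fscale_zero [simp]: "fscale c 0 = 0"
  by (rule ext) (simp add: fscale_def)

lemma fscale_zero_left [simp]: "fscale 0 w = 0"
  by (rule ext) (simp add: fscale_def)

lemma fscale_one [simp]: "fscale 1 w = w"
  by (simp add: fscale_def)

lemma fscale_fscale [simp]: "fscale c (fscale d w) = fscale (c * d) w"
  by (simp add: fscale_def)

lemma grade_inv_zero [simp]: "grade_inv 0 = 0"
  by (rule ext) (simp add: grade_inv_def)

lemma fconv_zero [simp]: "fconv \<Xi> X 0 = 0" "fconv \<Xi> 0 Y = 0"
  by (simp_all add: fconv_def fun_eq_iff)

text \<open>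
  Multiplying by \<open>w \<otimes> 1\<close> leaves a single term in the convolution over the powers of \<open>z\<close>.
\<close>

lemma xmul_xten: "xmul \<Xi> (X, 0) (xten w 0) = (\<lambda>k. fmul \<Xi> (X k) w, 0)"
proof -
  have "fconv \<Xi> X (\<lambda>l. if l = 0 then w else 0) = (\<lambda>k. fmul \<Xi> (X k) w)"
  proof (intro ext)
    fix k I r
    have "fconv \<Xi> X (\<lambda>l. if l = 0 then w else 0) k I r =
        fmul \<Xi> (X k) (if k - k = 0 then w else 0) I r"
      unfolding fconv_def by (rule infsum_single_term) simp
    then show "fconv \<Xi> X (\<lambda>l. if l = 0 then w else 0) k I r = fmul \<Xi> (X k) w I r" by simp
  qed
  then show ?thesis by (simp add: xmul_def xten_def)
qed

lemma xmul_zero_left: "xmul \<Xi> 0 B = 0"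
  by (simp add: xmul_def prod_eq_iff)

lemma xmul_xten_xten: "xmul \<Xi> (xten v 0) (xten w 0) = xten (fmul \<Xi> v w) 0"
proof -
  have "xmul \<Xi> (xten v 0) (xten w 0) = (\<lambda>k. fmul \<Xi> (if k = 0 then v else 0) w, 0)"
    unfolding xten_def[of v] by (rule xmul_xten)
  then show ?thesis by (auto simp: xten_def)
qed

lemma xstar_xten: "xstar \<Xi> (xten w 0) = xten (fstar \<Xi> w) 0"
  by (auto simp: xstar_def xten_def fstar_def tstar_def fun_eq_iff)

lemma xd_xten: "xd m \<Xi> (xten w 0) = xten (ext_d m \<Xi> w) 0"
  by (auto simp: xd_def xten_def)

lemma xscale_xten: "xscale c (xten w 0) = xten (fscale c w) 0"
  by (auto simp: xscale_def xten_def)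

lemma fstar_emb: "fstar \<Xi> (emb x) = emb (tstar \<Xi> x)"
  by (auto simp: fstar_def emb_def tstar_def fun_eq_iff)

lemma gen_in_torus: "j \<in> {1..m} \<Longrightarrow> gen j \<in> torus m"
  unfolding gen_def by (rule qmon_in_torus) (simp add: multi_index_def)

lemma delta_gen: "delta i (gen j) = (if i = j then tscale (2 * of_real pi * \<i>) (gen j) else 0)"
  by (auto simp: delta_def gen_def qmon_def tscale_def fun_eq_iff)

text \<open>
  The identity evaluates the coaction on \<open>d\<bbbU>\<^sub>j\<close>, which is given through \<open>u\<^sub>j\<^sup>* du\<^sub>j\<close>. For \<open>j = n + 1\<close> it shows that
  the canonical connection is a constant form.
\<close>

lemma gen_star_d_gen:
  assumes "j \<in> {1..m}"
  shows "fmul \<Xi> (emb (tstar \<Xi> (gen j))) (ext_d m \<Xi> (emb (gen j))) = fscale (- 2 * of_real pi) (dU {j})"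
proof
  fix K
  have "ext_d m \<Xi> (emb (gen j)) K = (\<Sum>i=1..m. if i = j then (if K = {j} then tscale (- 2 * of_real pi) (gen j) else 0) else 0)"
    unfolding ext_d_emb
  proof (intro sum.cong refl)
    have *: "\<i> * (2 * of_real pi * \<i>) = - 2 * complex_of_real pi" by (simp add: algebra_simps)
    fix i
    show "(if K = {i} then tscale \<i> (delta i (gen j)) else 0) =
        (if i = j then (if K = {j} then tscale (- 2 * of_real pi) (gen j) else 0) else 0)"
      by (simp only: delta_gen tscale_tscale * if_cancel tscale_zero split: if_split) simp
  qed
  then have "ext_d m \<Xi> (emb (gen j)) K = (if K = {j} then tscale (- 2 * of_real pi) (gen j) else 0)"
    using assms by simp
  then show "fmul \<Xi> (emb (tstar \<Xi> (gen j))) (ext_d m \<Xi> (emb (gen j))) K = fscale (- 2 * of_real pi) (dU {j}) K"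
    by (auto simp: fmul_emb_apply tmul_scale_right tmul_star_gen fscale_def dU_def)
qed

text \<open>
  The generators \<open>u\<^sub>1, \<dots>, u\<^sub>n\<close> of the base are coinvariant, so no power of \<open>z\<close> is created whose
  differential would contribute a multiple of \<open>\<vartheta>\<close>.
\<close>

lemma coact_dU_base:
  assumes "j \<in> {1..n}"
  shows "coact_dU n \<Xi> j = xten (dU {j}) 0"
proof -
  have "coact_form n (gen j) = xten (emb (gen j)) 0"
    by (auto simp: coact_form_def xten_def coact_base[OF gen_in_torus[OF assms]])
  then have "coact_dU n \<Xi> j = xscale (- 1 / (2 * of_real pi))
      (xten (fmul \<Xi> (emb (tstar \<Xi> (gen j))) (ext_d (Suc n) \<Xi> (emb (gen j)))) 0)"
    by (simp only: coact_dU_def xstar_xten xd_xten xmul_xten_xten fstar_emb)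
  also have "\<dots> = xten (dU {j}) 0"
    using assms by (subst gen_star_d_gen) (auto simp: xscale_xten)
  finally show ?thesis .
qed

text \<open>
  No sign appears because \<open>j\<close> precedes all elements of \<open>I\<close>.
\<close>

lemma fmul_dU_insert:
  assumes "finite I" "\<And>i. i \<in> I \<Longrightarrow> j < i"
  shows "fmul \<Xi> (dU {j}) (dU I) = dU (insert j I)"
proof
  fix K
  show "fmul \<Xi> (dU {j}) (dU I) K = dU (insert j I) K"
  proof (cases "finite K")
    case True
    have "j \<notin> I" using assms(2) by blast
    then have *: "I \<subseteq> K \<and> K - I = {j} \<longleftrightarrow> K = insert j I" by auto
    have "{(i, i'). i \<in> {j} \<and> i' \<in> I \<and> i' < i} = {}" using assms(2) by fastforce
    then have "wsgn {j} I = 1" by (simp only: wsgn_def card.empty power_0)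
    then have "fmul \<Xi> (dU {j}) (dU I) K = (if I \<subseteq> K \<and> K - I = {j} then tone else 0)"
      unfolding fmul_dU_apply[OF True] by (simp add: dU_def)
    also have "\<dots> = dU (insert j I) K" unfolding * dU_def ..
    finally show ?thesis .
  next
    case False
    with assms(1) show ?thesis by (auto simp: fmul_infinite dU_def)
  qed
qed

lemma foldr_coact_dU:
  assumes "set xs \<subseteq> {1..n}" "sorted_wrt (<) xs"
  shows "foldr (xmul \<Xi>) (map (coact_dU n \<Xi>) xs) (xten fone 0) = xten (dU (set xs)) 0"
  using assms
proof (induction xs)
  case Nil
  have "fone = dU {}" by (simp add: fone_def emb_def dU_def)
  then show ?case by simp
next
  case (Cons j xs)
  then show ?case
    by (simp add: coact_dU_base xmul_xten_xten fmul_dU_insert)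
qed

text \<open>
  A horizontal form is a combination of the products of \<open>d\<bbbU>\<^sub>1, \<dots>, d\<bbbU>\<^sub>n\<close>, which are coinvariant, so
  the coaction only sees the coefficients.
\<close>

lemma coact_Omega_base:
  assumes w: "w \<in> Omega (Suc n)" and hor: "\<And>I. \<not> I \<subseteq> {1..n} \<Longrightarrow> w I = 0"
  shows "coact_Omega n \<Xi> w = (\<lambda>k I. coact n (w I) k, 0)"
proof -
  have summand: "xmul \<Xi> (coact_form n (w I))
      (foldr (xmul \<Xi>) (map (coact_dU n \<Xi>) (sorted_list_of_set I)) (xten fone 0)) =
      (\<lambda>k K. if K = I then coact n (w I) k else 0, 0)" if "I \<in> Pow {1..Suc n}" for I
  proof (cases "I \<subseteq> {1..n}")
    case True
    then have fin: "finite I" by (rule finite_subset) simp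
    have "foldr (xmul \<Xi>) (map (coact_dU n \<Xi>) (sorted_list_of_set I)) (xten fone 0) = xten (dU I) 0"
      using foldr_coact_dU[of "sorted_list_of_set I" n \<Xi>] True fin by simp
    moreover have "fmul \<Xi> (emb y) (dU I) = (\<lambda>K. if K = I then y else 0)" for y
      using fin by (auto simp: fmul_emb_apply dU_def)
    ultimately show ?thesis by (simp add: coact_form_def xmul_xten)
  next
    case False
    then have "w I = 0" by (rule hor)
    moreover have "coact_form n 0 = 0" by (auto simp: coact_form_def prod_eq_iff fun_eq_iff)
    moreover have "(\<lambda>k K. if K = I then coact n 0 k else 0) = (0 :: int \<Rightarrow> form)"
      by (intro ext) simp
    ultimately show ?thesis by (simp only: xmul_zero_left) (simp add: prod_eq_iff)
  qed
  have "coact_Omega n \<Xi> w = (\<Sum>I\<in>Pow {1..Suc n}. (\<lambda>k K. if K = I then coact n (w I) k else 0, 0))"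
    unfolding coact_Omega_def by (rule sum.cong[OF refl summand])
  also have "\<dots> = (\<lambda>k I. coact n (w I) k, 0)"
  proof (rule prod_eqI)
    show "fst (\<Sum>I\<in>Pow {1..Suc n}. (\<lambda>k K. if K = I then coact n (w I) k else 0, 0 :: int \<Rightarrow> form)) =
        fst (\<lambda>k I. coact n (w I) k, 0 :: int \<Rightarrow> form)"
    proof (rule ext, rule ext)
      fix k K
      have "(\<Sum>I\<in>Pow {1..Suc n}. if K = I then coact n (w I) k else 0) = coact n (w K) k"
        using OmegaD(2)[OF w, of K] by (cases "K \<subseteq> {1..Suc n}") (simp_all add: sum.delta)
      then show "fst (\<Sum>I\<in>Pow {1..Suc n}. (\<lambda>k K. if K = I then coact n (w I) k else 0, 0 :: int \<Rightarrow> form)) k K =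
          fst (\<lambda>k I. coact n (w I) k, 0 :: int \<Rightarrow> form) k K"
        by (simp add: fst_sum sum_apply)
    qed
  qed (simp add: snd_sum)
  finally show ?thesis .
qed

text \<open>
  A base form is its product with \<open>1\<close>, a sum with one summand.
\<close>

lemma Omega_subset_Hor:
  assumes "w \<in> Omega n"
  shows "w \<in> Hor n \<Xi>"
proof -
  have "fmul \<Xi> (emb tone) w = w" by (simp add: fmul_emb[OF assms])
  then have "(\<forall>i<1::nat. tone \<in> torus (Suc n) \<and> w \<in> Omega n) \<and> w = (\<Sum>i<1::nat. fmul \<Xi> (emb tone) w)"
    using tone_in_torus assms by simp
  then have "\<exists>(N::nat) x v. (\<forall>i<N. x i \<in> torus (Suc n) \<and> v i \<in> Omega n) \<and>
      w = (\<Sum>i<N. fmul \<Xi> (emb (x i)) (v i))"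
    by (intro exI[of _ "1::nat"] exI[of _ "\<lambda>_. tone"] exI[of _ "\<lambda>_. w"])
  with Omega_Suc_base[OF assms] show ?thesis
    unfolding Hor_def by (intro CollectI conjI)
qed

lemma Hor_support:
  assumes "w \<in> Hor n \<Xi>" "\<not> K \<subseteq> {1..n}"
  shows "w K = 0"
proof -
  have "\<exists>(N::nat) x v. (\<forall>i<N. x i \<in> torus (Suc n) \<and> v i \<in> Omega n) \<and>
      w = (\<Sum>i<N. fmul \<Xi> (emb (x i)) (v i))"
    using assms(1) by (simp only: Hor_def mem_Collect_eq)
  then obtain N :: nat and x v where v: "\<forall>i<N. x i \<in> torus (Suc n) \<and> v i \<in> Omega n"
    and w: "w = (\<Sum>i<N. fmul \<Xi> (emb (x i)) (v i))"
    by (elim exE conjE)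
  have "v i K = 0" if "i < N" for i
    using v that OmegaD(2)[OF _ assms(2)] by blast
  then have "fmul \<Xi> (emb (x i)) (v i) K = 0" if "i < N" for i
    using that by (simp only: fmul_emb_apply tmul_zero_right if_cancel)
  then have "(\<Sum>i<N. fmul \<Xi> (emb (x i)) (v i) K) = 0"
    by (intro sum.neutral ballI) simp
  then show ?thesis unfolding w by (subst sum_apply)
qed

text \<open>
  The line \<open>\<complex>\<vartheta>\<close> is spanned by \<open>\<vartheta>\<close>, so a linear map on it is given by its value at \<open>\<vartheta>\<close>.
\<close>

lemma linear_tscale_iff:
  "Vector_Spaces.linear (*) tscale T \<longleftrightarrow> (\<exists>x. T = (\<lambda>t. tscale t x))"
proof
  assume "Vector_Spaces.linear (*) tscale T"
  then have *: "\<forall>c x. T (c * x) = tscale c (T x)" unfolding Vector_Spaces.linear_iff by (elim conjE)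
  have "T = (\<lambda>t. tscale t (T 1))"
  proof
    fix t
    show "T t = tscale t (T 1)" using *[rule_format, of t 1] unfolding mult_1_right .
  qed
  then show "\<exists>x. T = (\<lambda>t. tscale t x)" by (rule exI[where x = "T 1"])
next
  assume "\<exists>x. T = (\<lambda>t. tscale t x)"
  then obtain x where T: "T = (\<lambda>t. tscale t x)" by (elim exE)
  have "vector_space ((*) :: complex \<Rightarrow> complex \<Rightarrow> complex)" "vector_space tscale"
    by (unfold_locales; simp add: algebra_simps tscale_add tscale_add_left)+
  then show "Vector_Spaces.linear (*) tscale T"
    unfolding Vector_Spaces.linear_iff by (simp add: T tscale_add_left)
qed

lemma fscale_add: "fscale c (v + w) = fscale c v + fscale c w"
  by (rule ext) (simp add: fscale_def tscale_add)

lemma fscale_add_left: "fscale (c + d) w = fscale c w + fscale d w"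
  by (rule ext) (simp add: fscale_def tscale_add_left)

lemma linear_fscale_iff:
  "Vector_Spaces.linear (*) fscale T \<longleftrightarrow> (\<exists>x. T = (\<lambda>t. fscale t x))"
proof
  assume "Vector_Spaces.linear (*) fscale T"
  then have *: "\<forall>c x. T (c * x) = fscale c (T x)" unfolding Vector_Spaces.linear_iff by (elim conjE)
  have "T = (\<lambda>t. fscale t (T 1))"
  proof
    fix t
    show "T t = fscale t (T 1)" using *[rule_format, of t 1] unfolding mult_1_right .
  qed
  then show "\<exists>x. T = (\<lambda>t. fscale t x)" by (rule exI[where x = "T 1"])
next
  assume "\<exists>x. T = (\<lambda>t. fscale t x)"
  then obtain x where T: "T = (\<lambda>t. fscale t x)" by (elim exE)
  have "vector_space ((*) :: complex \<Rightarrow> complex \<Rightarrow> complex)" "vector_space fscale"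
    by (unfold_locales; simp add: algebra_simps fscale_add fscale_add_left)+
  then show "Vector_Spaces.linear (*) fscale T"
    unfolding Vector_Spaces.linear_iff by (simp add: T fscale_add_left)
qed

lemma coact_invariant_iff:
  assumes "x \<in> torus (Suc n)"
  shows "(\<forall>k. coact n x k = (if k = 0 then x else 0)) \<longleftrightarrow> x \<in> torus n"
proof
  assume *: "\<forall>k. coact n x k = (if k = 0 then x else 0)"
  have "x r = 0" if "r (Suc n) \<noteq> 0" for r
    using *[rule_format, of 0] that by (auto simp: coact_def dest!: fun_cong[where x=r])
  with assms show "x \<in> torus n" using torus_Suc_iff by blast
qed (simp add: coact_base)

lemma lookup_ad: "Poly_Mapping.lookup (ad t) k = (if k = 0 then t else 0)"
  by (simp add: ad_def lookup_single when_def)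

text \<open>
  Since \<open>ad \<vartheta> = \<vartheta> \<otimes> 1\<close>, the intertwining condition says that the value at \<open>\<vartheta>\<close> is coinvariant, that
  is, free of \<open>u\<^sub>n\<^sub>+\<^sub>1\<close>. This makes the module of intertwiners free of rank one.
\<close>

lemma Mor_P_eq: "Mor_P n = (\<lambda>x t. tscale t x) ` torus n"
proof -
  have coact: "coact n y = (\<lambda>k. tscale (if k = 0 then t else 0) x) \<longleftrightarrow>
      (\<forall>k. coact n y k = (if k = 0 then y else 0))" if "y = tscale t x" for t x y
    using that by (auto simp: fun_eq_iff)
  have "(\<forall>t. tscale t x \<in> torus (Suc n) \<and>
      coact n (tscale t x) = (\<lambda>k. tscale (Poly_Mapping.lookup (ad t) k) x)) \<longleftrightarrow> x \<in> torus n" for x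
  proof
    assume "\<forall>t. tscale t x \<in> torus (Suc n) \<and>
      coact n (tscale t x) = (\<lambda>k. tscale (Poly_Mapping.lookup (ad t) k) x)"
    then have "tscale 1 x \<in> torus (Suc n)" "\<forall>k. coact n (tscale 1 x) k = (if k = 0 then tscale 1 x else 0)"
      unfolding lookup_ad by (blast, subst coact[OF refl, symmetric]) blast
    then show "x \<in> torus n" using coact_invariant_iff[of x n] unfolding tscale_one by blast
  next
    assume x: "x \<in> torus n"
    show "\<forall>t. tscale t x \<in> torus (Suc n) \<and>
      coact n (tscale t x) = (\<lambda>k. tscale (Poly_Mapping.lookup (ad t) k) x)"
      unfolding lookup_ad
    proof (intro allI conjI)
      fix t
      have t: "tscale t x \<in> torus n" using x by (rule torus_scale)
      then show t': "tscale t x \<in> torus (Suc n)"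
        using torus_Suc_iff by blast
      show "coact n (tscale t x) = (\<lambda>k. tscale (if k = 0 then t else 0) x)"
        unfolding coact[OF refl] using coact_invariant_iff[OF t'] t by blast
    qed
  qed
  then have "(\<lambda>t. tscale t x) \<in> Mor_P n \<longleftrightarrow> x \<in> torus n" for x
    unfolding Mor_P_def mem_Collect_eq linear_tscale_iff by blast
  moreover have "\<exists>x. T = (\<lambda>t. tscale t x)" if "T \<in> Mor_P n" for T
    using that unfolding Mor_P_def mem_Collect_eq linear_tscale_iff by (elim conjE)
  ultimately show ?thesis by blast
qed

text \<open>
  The coinvariant horizontal forms are the base forms: horizontality removes the index \<open>n + 1\<close> of
  the form degree, and coinvariance removes \<open>u\<^sub>n\<^sub>+\<^sub>1\<close> from the coefficients.
\<close>

lemma coact_Omega_invariant_iff: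
  "w \<in> Hor n \<Xi> \<and> coact_Omega n \<Xi> w = (\<lambda>k. if k = 0 then w else 0, 0) \<longleftrightarrow> w \<in> Omega n"
proof
  assume *: "w \<in> Hor n \<Xi> \<and> coact_Omega n \<Xi> w = (\<lambda>k. if k = 0 then w else 0, 0)"
  then have w: "w \<in> Omega (Suc n)" by (simp add: Hor_def)
  have hor: "w I = 0" if "\<not> I \<subseteq> {1..n}" for I
    using * that by (intro Hor_support[of _ n \<Xi>]) simp_all
  have "(\<lambda>k I. coact n (w I) k, 0) = (\<lambda>k. if k = 0 then w else 0, 0 :: int \<Rightarrow> form)"
    using * coact_Omega_base[OF w hor, of \<Xi>] by simp
  then have eq: "(\<lambda>k I. coact n (w I) k) = (\<lambda>k. if k = 0 then w else 0)"
    by (rule Pair_inject)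
  have "coact n (w I) k = (if k = 0 then w I else 0)" for I k
    using fun_cong[OF fun_cong[OF eq, of k], of I] by (cases "k = 0") simp_all
  then have "w I \<in> torus n" for I
    using coact_invariant_iff[OF OmegaD(1)[OF w]] by blast
  then show "w \<in> Omega n" using hor by (rule OmegaI)
next
  assume w: "w \<in> Omega n"
  have "coact_Omega n \<Xi> w = (\<lambda>k I. coact n (w I) k, 0)"
    by (rule coact_Omega_base[OF Omega_Suc_base[OF w] OmegaD(2)[OF w]])
  also have "\<dots> = (\<lambda>k. if k = 0 then w else 0, 0)"
    by (auto simp: coact_base OmegaD(1)[OF w] fun_eq_iff)
  finally show "w \<in> Hor n \<Xi> \<and> coact_Omega n \<Xi> w = (\<lambda>k. if k = 0 then w else 0, 0)"
    using Omega_subset_Hor[OF w] by blast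
qed

lemma Mor_Hor_eq: "Mor_Hor n \<Xi> = (\<lambda>w t. fscale t w) ` Omega n"
proof -
  have coact: "(\<lambda>k. fscale (Poly_Mapping.lookup (ad t) k) w, 0 :: int \<Rightarrow> form) =
      (\<lambda>k. if k = 0 then fscale t w else 0, 0)" for t w
    by (auto simp: lookup_ad)
  have "(\<lambda>t. fscale t w) \<in> Mor_Hor n \<Xi> \<longleftrightarrow> (\<forall>t. fscale t w \<in> Omega n)" for w
    unfolding Mor_Hor_def mem_Collect_eq linear_fscale_iff coact coact_Omega_invariant_iff by blast
  then have "(\<lambda>t. fscale t w) \<in> Mor_Hor n \<Xi> \<longleftrightarrow> w \<in> Omega n" for w
    using Omega_scale fscale_one by metis
  moreover have "\<exists>w. T = (\<lambda>t. fscale t w)" if "T \<in> Mor_Hor n \<Xi>" for T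
    using that unfolding Mor_Hor_def mem_Collect_eq linear_fscale_iff by (elim conjE)
  ultimately show ?thesis by blast
qed

lemma lookup_antipode: "Poly_Mapping.lookup (antipode g) k = Poly_Mapping.lookup g (- k)"
proof -
  have "Poly_Mapping.lookup (antipode g) k =
      (\<Sum>j\<in>Poly_Mapping.keys g. if j = - k then Poly_Mapping.lookup g (- k) else 0)"
    unfolding antipode_def lookup_sum by (intro sum.cong refl) (auto simp: lookup_single when_def)
  also have "\<dots> = Poly_Mapping.lookup g (- k)"
    by (simp add: in_keys_iff)
  finally show ?thesis .
qed

text \<open>
  The antipode reverses the exponents, so it is an involution and its own inverse.
\<close>

lemma inv_antipode_zpow: "inv_into UNIV antipode (zpow k) = zpow (- k)"
proof (rule inv_into_f_eq)
  show "inj antipode"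
    by (rule inj_on_inverseI[where g = antipode]) (simp add: poly_mapping_eq_iff fun_eq_iff lookup_antipode)
  show "antipode (zpow (- k)) = zpow k"
    by (auto simp: poly_mapping_eq_iff fun_eq_iff lookup_antipode zpow_def lookup_single when_def)
qed simp

lemma germs_zpow: "germs (zpow k) = of_int k"
  by (simp add: germs_def zpow_def theta_def)

text \<open>
  A base form has only a component of charge \<open>0\<close>, and the germ of \<open>z\<^sup>0 = 1\<close> is \<open>0\<close>. The connection
  therefore drops out of its covariant derivative.
\<close>

lemma dual_D_base:
  assumes "w \<in> Omega n" and "\<omega> 0 = 0"
  shows "dual_D n \<Xi> \<omega> w = ext_d n \<Xi> w"
proof -
  have "coact_Omega n \<Xi> w = (\<lambda>k I. if k = 0 then w I else 0, 0)"
    using coact_Omega_base[OF Omega_Suc_base[OF assms(1)] OmegaD(2)[OF assms(1)], of \<Xi>]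
    by (simp add: coact_base[OF OmegaD(1)[OF assms(1)]])
  then have c: "fst (coact_Omega n \<Xi> w) k = (if k = 0 then w else 0)" for k
    by auto
  have "fmul \<Xi> (\<omega> (germs (inv_into UNIV antipode (zpow k)))) (fst (coact_Omega n \<Xi> w) k) = 0" for k
    using assms(2) by (cases "k = 0") (simp_all add: c inv_antipode_zpow germs_zpow)
  then have "(\<lambda>I r. \<Sum>\<^sub>\<infinity>k. fmul \<Xi> (\<omega> (germs (inv_into UNIV antipode (zpow k))))
      (fst (coact_Omega n \<Xi> w) k) I r) = 0"
    by (intro ext) simp
  then show ?thesis
    by (simp add: dual_D_def ext_d_Suc_base[OF assms(1)])
qed

section \<open>The tensor product as the module of base forms\<close>

text \<open>
  This is the map from the free abelian group by which homomorphisms on the tensor product are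
  defined. The product over the support of an element can be extended to any finite set of
  generators, and a common such set for two elements makes the map visibly multiplicative.
\<close>

lemma finprod_frag_hom:
  fixes S :: "'p set"
  assumes B: "comm_group B" and f: "\<And>p. p \<in> S \<Longrightarrow> f p \<in> carrier B"
  shows "(\<lambda>c. finprod B (\<lambda>p. f p [^]\<^bsub>B\<^esub> Poly_Mapping.lookup c p) (Poly_Mapping.keys c))
    \<in> hom (free_Abelian_group S) B"
proof -
  interpret comm_group B by (rule B)
  let ?\<phi> = "\<lambda>c. finprod B (\<lambda>p. f p [^]\<^bsub>B\<^esub> Poly_Mapping.lookup c p) (Poly_Mapping.keys c)"
  have ext: "?\<phi> c = finprod B (\<lambda>p. f p [^]\<^bsub>B\<^esub> Poly_Mapping.lookup c p) A"
    if "finite A" "Poly_Mapping.keys c \<subseteq> A" "A \<subseteq> S" for c :: "'p \<Rightarrow>\<^sub>0 int" and A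
    using that f by (intro finprod_mono_neutral_cong_left) (auto simp: in_keys_iff)
  show ?thesis
  proof (rule homI)
    fix c assume "c \<in> carrier (free_Abelian_group S)"
    then show "?\<phi> c \<in> carrier B" using f by (intro finprod_closed) auto
  next
    fix c d assume "c \<in> carrier (free_Abelian_group S)" "d \<in> carrier (free_Abelian_group S)"
    then have cd: "Poly_Mapping.keys c \<subseteq> S" "Poly_Mapping.keys d \<subseteq> S" by simp_all
    let ?A = "Poly_Mapping.keys c \<union> Poly_Mapping.keys d"
    have A: "finite ?A" "?A \<subseteq> S" using cd by auto
    have "?\<phi> (c + d) = finprod B (\<lambda>p. f p [^]\<^bsub>B\<^esub> Poly_Mapping.lookup (c + d) p) ?A"
      using A keys_add[of c d] by (intro ext) auto
    also have "\<dots> = finprod B (\<lambda>p. f p [^]\<^bsub>B\<^esub> Poly_Mapping.lookup c p \<otimes>\<^bsub>B\<^esub> f p [^]\<^bsub>B\<^esub> Poly_Mapping.lookup d p) ?A"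
      using A f by (intro finprod_cong) (auto simp: lookup_add int_pow_mult simp_implies_def)
    also have "\<dots> = finprod B (\<lambda>p. f p [^]\<^bsub>B\<^esub> Poly_Mapping.lookup c p) ?A \<otimes>\<^bsub>B\<^esub>
        finprod B (\<lambda>p. f p [^]\<^bsub>B\<^esub> Poly_Mapping.lookup d p) ?A"
      using A f by (intro finprod_multf) auto
    also have "\<dots> = ?\<phi> c \<otimes>\<^bsub>B\<^esub> ?\<phi> d"
      using A by (simp add: ext[of ?A c] ext[of ?A d])
    finally show "?\<phi> (c \<otimes>\<^bsub>free_Abelian_group S\<^esub> d) = ?\<phi> c \<otimes>\<^bsub>B\<^esub> ?\<phi> d" by simp
  qed
qed

lemma hom_free_diff:
  assumes B: "group B" and \<phi>: "\<phi> \<in> hom (free_Abelian_group S) B"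
    and "Poly_Mapping.keys a \<subseteq> S" "Poly_Mapping.keys b \<subseteq> S"
  shows "\<phi> (a - b) = \<phi> a \<otimes>\<^bsub>B\<^esub> inv\<^bsub>B\<^esub> \<phi> b"
proof -
  interpret group_hom "free_Abelian_group S" B \<phi>
    using B \<phi> by (simp add: group_hom_def group_hom_axioms_def)
  have b: "inv\<^bsub>free_Abelian_group S\<^esub> b = - b" using assms(4) by (rule inv_free_Abelian_group)
  have "a - b = a \<otimes>\<^bsub>free_Abelian_group S\<^esub> inv\<^bsub>free_Abelian_group S\<^esub> b" unfolding b by simp
  also have "\<phi> \<dots> = \<phi> a \<otimes>\<^bsub>B\<^esub> inv\<^bsub>B\<^esub> \<phi> b"
    using assms(3,4) by (subst hom_mult, simp, simp add: b, subst hom_inv) simp_all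
  finally show ?thesis .
qed

lemma Mor_PI: "x \<in> torus n \<Longrightarrow> (\<lambda>t. tscale t x) \<in> Mor_P n"
  by (simp add: Mor_P_eq)

lemma Mor_PD:
  assumes "T \<in> Mor_P n"
  shows "T 1 \<in> torus n" "(\<lambda>t. tscale t (T 1)) = T"
  using assms by (auto simp: Mor_P_eq)

lemma Mor_P_add:
  assumes "T \<in> Mor_P n" "T' \<in> Mor_P n"
  shows "T + T' \<in> Mor_P n"
proof -
  have "(\<lambda>t. tscale t (T 1 + T' 1)) = (\<lambda>t. tscale t (T 1)) + (\<lambda>t. tscale t (T' 1))"
    by (rule ext) (simp add: tscale_add)
  also have "\<dots> = T + T'" by (simp only: Mor_PD(2)[OF assms(1)] Mor_PD(2)[OF assms(2)])
  finally show ?thesis using Mor_PI[OF torus_add[OF Mor_PD(1)[OF assms(1)] Mor_PD(1)[OF assms(2)]]]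
    by (simp only:)
qed

lemma Mor_P_tmul:
  assumes "T \<in> Mor_P n" "b \<in> torus n"
  shows "(\<lambda>t. tmul \<Xi> (T t) b) \<in> Mor_P n"
proof -
  have "(\<lambda>t. tmul \<Xi> (tscale t (T 1)) b) = (\<lambda>t. tscale t (tmul \<Xi> (T 1) b))"
    by (simp only: tmul_scale_left)
  moreover have "(\<lambda>t. tmul \<Xi> (tscale t (T 1)) b) = (\<lambda>t. tmul \<Xi> (T t) b)"
    by (simp only: fun_cong[OF Mor_PD(2)[OF assms(1)]])
  ultimately show ?thesis
    using Mor_PI[OF tmul_closed[OF Mor_PD(1)[OF assms(1)] assms(2)]] by (simp only:)
qed

lemma frag_of_in_Efree: "T \<in> Mor_P n \<Longrightarrow> \<mu> \<in> Omega n \<Longrightarrow> frag_of (T, \<mu>) \<in> carrier (Efree n)"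
  by (simp add: Efree_def)

lemma Efree_diff:
  "a \<in> carrier (Efree n) \<Longrightarrow> b \<in> carrier (Efree n) \<Longrightarrow> a - b \<in> carrier (Efree n)"
  using keys_diff[of a b] unfolding Efree_def carrier_free_Abelian_group_iff by blast

lemma Erel_carrier: "Erel n \<Xi> \<subseteq> carrier (Efree n)"
proof -
  have "c \<in> carrier (Efree n)" if "c \<in> Erel n \<Xi>" for c
    using that unfolding Erel_def
  proof (elim UnE CollectE exE conjE)
    fix T T' \<mu>
    assume "c = frag_of (T + T', \<mu>) - frag_of (T, \<mu>) - frag_of (T', \<mu>)"
      "T \<in> Mor_P n" "T' \<in> Mor_P n" "\<mu> \<in> Omega n"
    then show ?thesis by (simp only: Efree_diff frag_of_in_Efree Mor_P_add)
  next
    fix T \<mu> \<mu>'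
    assume "c = frag_of (T, \<mu> + \<mu>') - frag_of (T, \<mu>) - frag_of (T, \<mu>')"
      "T \<in> Mor_P n" "\<mu> \<in> Omega n" "\<mu>' \<in> Omega n"
    then show ?thesis by (simp only: Efree_diff frag_of_in_Efree Omega_add)
  next
    fix T b \<mu>
    assume "c = frag_of (\<lambda>t. tmul \<Xi> (T t) b, \<mu>) - frag_of (T, fmul \<Xi> (emb b) \<mu>)"
      "T \<in> Mor_P n" "b \<in> torus n" "\<mu> \<in> Omega n"
    then show ?thesis by (simp only: Efree_diff frag_of_in_Efree Mor_P_tmul fmul_emb_in_Omega)
  qed
  then show ?thesis by blast
qed

lemma comm_group_Efree: "comm_group (Efree n)"
  unfolding Efree_def by (rule abelian_free_Abelian_group)

abbreviation Erel_span :: "nat \<Rightarrow> (nat \<Rightarrow> nat \<Rightarrow> real) \<Rightarrow> (epair \<Rightarrow>\<^sub>0 int) set" where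
  "Erel_span n \<Xi> \<equiv> generate (Efree n) (Erel n \<Xi>)"

lemma subgroup_Erel_span: "subgroup (Erel_span n \<Xi>) (Efree n)"
  using group.generate_is_subgroup[OF comm_group.axioms(2)[OF comm_group_Efree] Erel_carrier] .

lemma normal_Erel_span: "Erel_span n \<Xi> \<lhd> Efree n"
  by (rule comm_group.subgroup_imp_normal[OF comm_group_Efree subgroup_Erel_span])

lemma comm_group_EOmega: "comm_group (EOmega n \<Xi>)"
  unfolding EOmega_def by (rule comm_group.abelian_FactGroup[OF comm_group_Efree subgroup_Erel_span])

lemma group_EOmega: "group (EOmega n \<Xi>)"
  using comm_group.axioms(2)[OF comm_group_EOmega] .

text \<open>
  Any map that depends on \<open>T \<otimes> \<mu>\<close> only through the base form \<open>T(\<vartheta>) \<mu>\<close>, and additively so, respects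
  the relations of the tensor product: they turn into distributivity and \<open>(x b) \<mu> = x (b \<mu>)\<close>. The
  value at \<open>T\<^sub>0 \<otimes> v\<close> is \<open>g v\<close> because \<open>T\<^sub>0(\<vartheta>) v = v\<close>. All maps out of the tensor product that
  enter the Yang--Mills equation are obtained from this.
\<close>

lemma tens_lift_base:
  assumes B: "comm_group B"
    and g: "\<And>v. v \<in> Omega n \<Longrightarrow> g v \<in> carrier B"
    and g_add: "\<And>v w. v \<in> Omega n \<Longrightarrow> w \<in> Omega n \<Longrightarrow> g (v + w) = g v \<otimes>\<^bsub>B\<^esub> g w"
    and f: "\<And>x \<mu>. x \<in> torus n \<Longrightarrow> \<mu> \<in> Omega n \<Longrightarrow> f (\<lambda>t. tscale t x) \<mu> = g (fmul \<Xi> (emb x) \<mu>)"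
    and v: "v \<in> Omega n"
  shows "tens_lift B f (tens n \<Xi> (\<lambda>t. tscale t tone) v) = g v"
proof -
  interpret B: comm_group B by (rule B)
  have f': "f T \<mu> = g (fmul \<Xi> (emb (T 1)) \<mu>)" if "T \<in> Mor_P n" "\<mu> \<in> Omega n" for T \<mu>
    using f[OF Mor_PD(1)[OF that(1)] that(2)] unfolding Mor_PD(2)[OF that(1)] .
  define \<phi> where "\<phi> c = finprod B (\<lambda>p. f (fst p) (snd p) [^]\<^bsub>B\<^esub> Poly_Mapping.lookup c p)
             (Poly_Mapping.keys c)" for c :: "epair \<Rightarrow>\<^sub>0 int"
  have hom: "\<phi> \<in> hom (free_Abelian_group (Mor_P n \<times> Omega n)) B"
    unfolding \<phi>_def by (rule finprod_frag_hom[OF B]) (auto simp: f' intro!: g fmul_emb_in_Omega Mor_PD(1))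
  then interpret \<phi>: group_hom "Efree n" B \<phi>
    using B.is_group by (simp add: group_hom_def group_hom_axioms_def Efree_def)
  have gen: "\<phi> (frag_of (T, \<mu>)) = g (fmul \<Xi> (emb (T 1)) \<mu>)" if "T \<in> Mor_P n" "\<mu> \<in> Omega n" for T \<mu>
    using that g[OF fmul_emb_in_Omega[OF Mor_PD(1) that(2)]] by (simp add: \<phi>_def f')
  have diff: "\<phi> (a - b) = \<phi> a \<otimes>\<^bsub>B\<^esub> inv\<^bsub>B\<^esub> \<phi> b"
    if "a \<in> carrier (Efree n)" "b \<in> carrier (Efree n)" for a b
    using that by (intro hom_free_diff[OF B.is_group hom]) (simp_all add: Efree_def)
  note frag = frag_of_in_Efree and diff_closed = Efree_diff
  have cancel: "x \<otimes>\<^bsub>B\<^esub> y \<otimes>\<^bsub>B\<^esub> inv\<^bsub>B\<^esub> x \<otimes>\<^bsub>B\<^esub> inv\<^bsub>B\<^esub> y = \<one>\<^bsub>B\<^esub>"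
    if "x \<in> carrier B" "y \<in> carrier B" for x y
    using that B.r_inv[of "x \<otimes>\<^bsub>B\<^esub> y"] by (simp add: B.inv_mult B.m_assoc)
  have rel: "\<phi> c = \<one>\<^bsub>B\<^esub>" if "c \<in> Erel n \<Xi>" for c
    using that unfolding Erel_def
  proof (elim UnE CollectE exE conjE)
    fix T T' \<mu>
    assume *: "c = frag_of (T + T', \<mu>) - frag_of (T, \<mu>) - frag_of (T', \<mu>)"
      "T \<in> Mor_P n" "T' \<in> Mor_P n" "\<mu> \<in> Omega n"
    have "g (fmul \<Xi> (emb ((T + T') 1)) \<mu>) = g (fmul \<Xi> (emb (T 1)) \<mu>) \<otimes>\<^bsub>B\<^esub> g (fmul \<Xi> (emb (T' 1)) \<mu>)"
      using * by (simp add: fmul_emb_add_left[where m=n] Mor_PD(1) g_add fmul_emb_in_Omega)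
    then show "\<phi> c = \<one>\<^bsub>B\<^esub>"
      unfolding *(1) using *(2-)
      by (simp only: diff gen diff_closed frag Mor_P_add cancel g fmul_emb_in_Omega Mor_PD(1))
  next
    fix T \<mu> \<mu>'
    assume *: "c = frag_of (T, \<mu> + \<mu>') - frag_of (T, \<mu>) - frag_of (T, \<mu>')"
      "T \<in> Mor_P n" "\<mu> \<in> Omega n" "\<mu>' \<in> Omega n"
    have "g (fmul \<Xi> (emb (T 1)) (\<mu> + \<mu>')) = g (fmul \<Xi> (emb (T 1)) \<mu>) \<otimes>\<^bsub>B\<^esub> g (fmul \<Xi> (emb (T 1)) \<mu>')"
      using * by (simp add: fmul_emb_add[where m=n] Mor_PD(1) g_add fmul_emb_in_Omega)
    then show "\<phi> c = \<one>\<^bsub>B\<^esub>"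
      unfolding *(1) using *(2-)
      by (simp only: diff gen diff_closed frag Omega_add cancel g fmul_emb_in_Omega Mor_PD(1))
  next
    fix T b \<mu>
    assume *: "c = frag_of (\<lambda>t. tmul \<Xi> (T t) b, \<mu>) - frag_of (T, fmul \<Xi> (emb b) \<mu>)"
      "T \<in> Mor_P n" "b \<in> torus n" "\<mu> \<in> Omega n"
    show "\<phi> c = \<one>\<^bsub>B\<^esub>"
      unfolding *(1) using *(2-)
      by (simp only: diff gen frag Mor_P_tmul fmul_emb_in_Omega fmul_emb_fmul_emb[OF Mor_PD(1)]
          B.r_inv g Mor_PD(1))
  qed
  have rels: "\<phi> h = \<one>\<^bsub>B\<^esub>" if "h \<in> Erel_span n \<Xi>" for h
    using that
  proof (induction rule: generate.induct)
    case (inv h)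
    then have "h \<in> carrier (Efree n)" using Erel_carrier by blast
    then show ?case by (simp add: rel[OF inv])
  next
    case (eng h1 h2)
    have "h1 \<in> carrier (Efree n)" "h2 \<in> carrier (Efree n)"
      using eng(1,2) subgroup.mem_carrier[OF subgroup_Erel_span] by blast+
    with eng show ?case by simp
  qed (simp_all add: rel)
  let ?c = "frag_of (\<lambda>t. tscale t tone, v)"
  have T0: "(\<lambda>t. tscale t tone) \<in> Mor_P n" by (rule Mor_PI[OF tone_in_torus])
  have c: "?c \<in> carrier (Efree n)" by (rule frag[OF T0 v])
  have "\<phi> ?c = g v" using gen[OF T0 v] by (simp add: fmul_emb[OF v])
  \<comment> \<open>The value of the induced map is read off from the image of a coset, which has to be a singleton.\<close>
  moreover have "\<phi> ` (Erel_span n \<Xi> #>\<^bsub>Efree n\<^esub> ?c) = {\<phi> ?c}"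
  proof -
    have "\<phi> (h \<otimes>\<^bsub>Efree n\<^esub> ?c) = \<phi> ?c" if "h \<in> Erel_span n \<Xi>" for h
      using that subgroup.mem_carrier[OF subgroup_Erel_span that] c by (simp add: rels)
    then have "(\<lambda>h. \<phi> (h \<otimes>\<^bsub>Efree n\<^esub> ?c)) ` Erel_span n \<Xi> = (\<lambda>_. \<phi> ?c) ` Erel_span n \<Xi>"
      by (intro image_cong refl)
    also have "\<dots> = {\<phi> ?c}"
      using generate.one[of "Efree n" "Erel n \<Xi>"] by (simp add: image_constant[of "\<one>\<^bsub>Efree n\<^esub>"])
    finally show ?thesis unfolding r_coset_def image_UN by (simp add: UNION_singleton_eq_range)
  qed
  ultimately show ?thesis
    unfolding tens_lift_def tens_def \<phi>_def[symmetric] by simp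
qed

text \<open>
  The tensor \<open>T\<^sub>0 \<otimes> v\<close>, where \<open>T\<^sub>0\<close> generates the module of intertwiners and \<open>T\<^sub>0 \<vartheta> = 1\<close>.
\<close>

definition unit_tens :: "nat \<Rightarrow> (nat \<Rightarrow> nat \<Rightarrow> real) \<Rightarrow> form \<Rightarrow> (epair \<Rightarrow>\<^sub>0 int) set" where
  "unit_tens n \<Xi> v = tens n \<Xi> (\<lambda>t. tscale t tone) v"

lemma coset_hom:
  "(\<lambda>c. Erel_span n \<Xi> #>\<^bsub>Efree n\<^esub> c) \<in> hom (Efree n) (EOmega n \<Xi>)"
  unfolding EOmega_def by (rule normal.r_coset_hom_Mod[OF normal_Erel_span])

lemma coset_diff:
  assumes "a \<in> carrier (Efree n)" "b \<in> carrier (Efree n)"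
  shows "Erel_span n \<Xi> #>\<^bsub>Efree n\<^esub> (a - b) =
    (Erel_span n \<Xi> #>\<^bsub>Efree n\<^esub> a) \<otimes>\<^bsub>EOmega n \<Xi>\<^esub> inv\<^bsub>EOmega n \<Xi>\<^esub> (Erel_span n \<Xi> #>\<^bsub>Efree n\<^esub> b)"
  using hom_free_diff[OF group_EOmega coset_hom[unfolded Efree_def], folded Efree_def] assms
  by (simp add: Efree_def)

lemma coset_Erel:
  assumes "c \<in> Erel n \<Xi>"
  shows "Erel_span n \<Xi> #>\<^bsub>Efree n\<^esub> c = \<one>\<^bsub>EOmega n \<Xi>\<^esub>"
proof -
  have "Erel_span n \<Xi> #>\<^bsub>Efree n\<^esub> c = Erel_span n \<Xi>"
    using assms Erel_carrier
    by (intro group.coset_join2[OF comm_group.axioms(2)[OF comm_group_Efree]] subgroup_Erel_span generate.incl) auto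
  then show ?thesis by (simp add: EOmega_def)
qed

lemma tens_closed: "T \<in> Mor_P n \<Longrightarrow> \<mu> \<in> Omega n \<Longrightarrow> tens n \<Xi> T \<mu> \<in> carrier (EOmega n \<Xi>)"
  unfolding tens_def using hom_in_carrier[OF coset_hom] frag_of_in_Efree by blast

lemma unit_tens_closed: "v \<in> Omega n \<Longrightarrow> unit_tens n \<Xi> v \<in> carrier (EOmega n \<Xi>)"
  unfolding unit_tens_def by (rule tens_closed[OF Mor_PI[OF tone_in_torus]])

lemma Erel_add:
  "T \<in> Mor_P n \<Longrightarrow> v \<in> Omega n \<Longrightarrow> w \<in> Omega n \<Longrightarrow>
    frag_of (T, v + w) - frag_of (T, v) - frag_of (T, w) \<in> Erel n \<Xi>"
  unfolding Erel_def by blast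

lemma Erel_balanced:
  "T \<in> Mor_P n \<Longrightarrow> b \<in> torus n \<Longrightarrow> \<mu> \<in> Omega n \<Longrightarrow>
    frag_of (\<lambda>t. tmul \<Xi> (T t) b, \<mu>) - frag_of (T, fmul \<Xi> (emb b) \<mu>) \<in> Erel n \<Xi>"
  unfolding Erel_def by blast

text \<open>
  The intertwiner with value \<open>x\<close> at \<open>\<vartheta>\<close> is \<open>T\<^sub>0 x\<close>, and \<open>x\<close> moves across the tensor sign.
\<close>

lemma tens_eq_unit_tens:
  assumes "x \<in> torus n" "\<mu> \<in> Omega n"
  shows "tens n \<Xi> (\<lambda>t. tscale t x) \<mu> = unit_tens n \<Xi> (fmul \<Xi> (emb x) \<mu>)"
proof -
  interpret group "EOmega n \<Xi>" by (rule group_EOmega)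
  let ?T = "\<lambda>t. tscale t tone"
  have T: "?T \<in> Mor_P n" by (rule Mor_PI[OF tone_in_torus])
  have x: "(\<lambda>t. tscale t x) = (\<lambda>t. tmul \<Xi> (?T t) x)"
    by (simp add: tmul_scale_left)
  have "frag_of (\<lambda>t. tmul \<Xi> (?T t) x, \<mu>) - frag_of (?T, fmul \<Xi> (emb x) \<mu>) \<in> Erel n \<Xi>"
    by (rule Erel_balanced[OF T assms])
  then have "tens n \<Xi> (\<lambda>t. tscale t x) \<mu> \<otimes>\<^bsub>EOmega n \<Xi>\<^esub>
      inv\<^bsub>EOmega n \<Xi>\<^esub> unit_tens n \<Xi> (fmul \<Xi> (emb x) \<mu>) = \<one>\<^bsub>EOmega n \<Xi>\<^esub>"
    unfolding tens_def unit_tens_def x[symmetric]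
    using coset_diff[OF frag_of_in_Efree[OF Mor_PI[OF assms(1)] assms(2)]
        frag_of_in_Efree[OF T fmul_emb_in_Omega[OF assms]], of \<Xi> \<Xi>] coset_Erel
    by metis
  then show ?thesis
    using tens_closed[OF Mor_PI[OF assms(1)] assms(2)] unit_tens_closed[OF fmul_emb_in_Omega[OF assms]]
    by (metis inv_closed inv_equality inv_inv)
qed

lemma unit_tens_add:
  assumes "v \<in> Omega n" "w \<in> Omega n"
  shows "unit_tens n \<Xi> (v + w) = unit_tens n \<Xi> v \<otimes>\<^bsub>EOmega n \<Xi>\<^esub> unit_tens n \<Xi> w"
proof -
  interpret comm_group "EOmega n \<Xi>" by (rule comm_group_EOmega)
  let ?T = "\<lambda>t. tscale t tone"
  have T: "?T \<in> Mor_P n" by (rule Mor_PI[OF tone_in_torus])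
  note frag = frag_of_in_Efree[OF T]
  have vw: "v + w \<in> Omega n" by (rule Omega_add[OF assms])
  have "frag_of (?T, v + w) - frag_of (?T, v) \<in> carrier (Efree n)"
    using frag[OF vw] frag[OF assms(1)] keys_diff[of "frag_of (?T, v + w)" "frag_of (?T, v)"]
    unfolding Efree_def by auto
  then have "Erel_span n \<Xi> #>\<^bsub>Efree n\<^esub> (frag_of (?T, v + w) - frag_of (?T, v) - frag_of (?T, w)) =
    unit_tens n \<Xi> (v + w) \<otimes>\<^bsub>EOmega n \<Xi>\<^esub> inv\<^bsub>EOmega n \<Xi>\<^esub> unit_tens n \<Xi> v \<otimes>\<^bsub>EOmega n \<Xi>\<^esub> inv\<^bsub>EOmega n \<Xi>\<^esub> unit_tens n \<Xi> w"
    unfolding unit_tens_def tens_def using frag[OF vw] frag[OF assms(1)] frag[OF assms(2)]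
    by (simp only: coset_diff)
  moreover have "frag_of (?T, v + w) - frag_of (?T, v) - frag_of (?T, w) \<in> Erel n \<Xi>"
    by (rule Erel_add[OF T assms])
  ultimately have "unit_tens n \<Xi> (v + w) \<otimes>\<^bsub>EOmega n \<Xi>\<^esub> inv\<^bsub>EOmega n \<Xi>\<^esub> unit_tens n \<Xi> v \<otimes>\<^bsub>EOmega n \<Xi>\<^esub>
      inv\<^bsub>EOmega n \<Xi>\<^esub> unit_tens n \<Xi> w = \<one>\<^bsub>EOmega n \<Xi>\<^esub>"
    by (simp only: coset_Erel)
  then show ?thesis
    using unit_tens_closed[OF vw, of \<Xi>] unit_tens_closed[OF assms(1), of \<Xi>] unit_tens_closed[OF assms(2), of \<Xi>]
    by (metis inv_closed inv_equality inv_inv inv_solve_right m_closed m_comm)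
qed

lemma unit_tens_zero: "unit_tens n \<Xi> 0 = \<one>\<^bsub>EOmega n \<Xi>\<^esub>"
proof -
  interpret comm_group "EOmega n \<Xi>" by (rule comm_group_EOmega)
  have "unit_tens n \<Xi> 0 = unit_tens n \<Xi> 0 \<otimes>\<^bsub>EOmega n \<Xi>\<^esub> unit_tens n \<Xi> 0"
    using unit_tens_add[OF Omega_zero Omega_zero, of n \<Xi>] by simp
  then show ?thesis
    using unit_tens_closed[OF Omega_zero, of n \<Xi>] by (metis l_cancel_one)
qed

text \<open>
  Every element of the tensor product is a \<open>\<int>\<close>-combination of elementary tensors, and the tensors
  \<open>T\<^sub>0 \<otimes> v\<close> include these and form a subgroup.
\<close>

lemma EOmega_carrier: "carrier (EOmega n \<Xi>) = unit_tens n \<Xi> ` Omega n"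
proof
  interpret comm_group "EOmega n \<Xi>" by (rule comm_group_EOmega)
  show "carrier (EOmega n \<Xi>) \<subseteq> unit_tens n \<Xi> ` Omega n"
  proof
    fix C assume "C \<in> carrier (EOmega n \<Xi>)"
    then obtain c where c: "c \<in> carrier (Efree n)" and C: "C = Erel_span n \<Xi> #>\<^bsub>Efree n\<^esub> c"
      unfolding EOmega_def carrier_FactGroup by blast
    have "Poly_Mapping.keys c \<subseteq> Mor_P n \<times> Omega n" using c by (simp add: Efree_def)
    then have "c \<in> carrier (Efree n) \<and> Erel_span n \<Xi> #>\<^bsub>Efree n\<^esub> c \<in> unit_tens n \<Xi> ` Omega n"
    proof (induction c rule: frag_induction)
      case zero
      have "Erel_span n \<Xi> #>\<^bsub>Efree n\<^esub> 0 = \<one>\<^bsub>EOmega n \<Xi>\<^esub>"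
        using hom_one[OF coset_hom comm_group.axioms(2)[OF comm_group_Efree] group_EOmega]
        by (simp add: Efree_def)
      then have "Erel_span n \<Xi> #>\<^bsub>Efree n\<^esub> 0 = unit_tens n \<Xi> 0" by (simp only: unit_tens_zero)
      then show ?case using Omega_zero by (auto simp: Efree_def)
    next
      case (diff a b)
      then obtain v w where vw: "v \<in> Omega n" "w \<in> Omega n"
        "Erel_span n \<Xi> #>\<^bsub>Efree n\<^esub> a = unit_tens n \<Xi> v" "Erel_span n \<Xi> #>\<^bsub>Efree n\<^esub> b = unit_tens n \<Xi> w"
        by blast
      have "- w = fscale (- 1) w" by (simp add: fscale_def tscale_def fun_eq_iff)
      then have neg: "- w \<in> Omega n" using Omega_scale[OF vw(2)] by simp
      have "unit_tens n \<Xi> (- w) \<otimes>\<^bsub>EOmega n \<Xi>\<^esub> unit_tens n \<Xi> w = \<one>\<^bsub>EOmega n \<Xi>\<^esub>"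
        using unit_tens_add[OF neg vw(2), of \<Xi>] unit_tens_zero by simp
      then have "inv\<^bsub>EOmega n \<Xi>\<^esub> unit_tens n \<Xi> w = unit_tens n \<Xi> (- w)"
        by (intro inv_equality unit_tens_closed neg vw)
      then have "Erel_span n \<Xi> #>\<^bsub>Efree n\<^esub> (a - b) = unit_tens n \<Xi> (v + - w)"
        using diff vw neg unfolding unit_tens_add[OF vw(1) neg] by (simp add: coset_diff)
      moreover have "a - b \<in> carrier (Efree n)"
        using diff by (intro Efree_diff) blast+
      ultimately show ?case using Omega_add[OF vw(1) neg] by blast
    next
      case (one p)
      then obtain T \<mu> where p: "p = (T, \<mu>)" "T \<in> Mor_P n" "\<mu> \<in> Omega n" by blast
      have "tens n \<Xi> T \<mu> = unit_tens n \<Xi> (fmul \<Xi> (emb (T 1)) \<mu>)"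
        using tens_eq_unit_tens[OF Mor_PD(1)[OF p(2)] p(3)] unfolding Mor_PD(2)[OF p(2)] .
      then show ?case
        using p fmul_emb_in_Omega[OF Mor_PD(1)[OF p(2)] p(3)] frag_of_in_Efree
        by (auto simp: tens_def)
    qed
    then show "C \<in> unit_tens n \<Xi> ` Omega n" unfolding C by (rule conjunct2)
  qed
qed (auto intro: unit_tens_closed)

lemma comm_group_Mor_Hor_group: "comm_group (Mor_Hor_group n \<Xi>)"
proof (rule comm_groupI)
  fix \<sigma> \<tau> assume "\<sigma> \<in> carrier (Mor_Hor_group n \<Xi>)" "\<tau> \<in> carrier (Mor_Hor_group n \<Xi>)"
  then obtain v w where *: "v \<in> Omega n" "w \<in> Omega n" "\<sigma> = (\<lambda>t. fscale t v)" "\<tau> = (\<lambda>t. fscale t w)"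
    by (auto simp: Mor_Hor_group_def Mor_Hor_eq)
  have "\<sigma> + \<tau> = (\<lambda>t. fscale t (v + w))" by (rule ext) (simp add: * fscale_add)
  with * show "\<sigma> \<otimes>\<^bsub>Mor_Hor_group n \<Xi>\<^esub> \<tau> \<in> carrier (Mor_Hor_group n \<Xi>)"
    using Omega_add by (auto simp: Mor_Hor_group_def Mor_Hor_eq)
next
  have "0 = (\<lambda>t. fscale t 0)" by (rule ext) simp
  then show "\<one>\<^bsub>Mor_Hor_group n \<Xi>\<^esub> \<in> carrier (Mor_Hor_group n \<Xi>)"
    using Omega_zero[of n] unfolding Mor_Hor_group_def Mor_Hor_eq partial_object.simps monoid.simps
    by (rule image_eqI)
next
  fix \<tau> assume "\<tau> \<in> carrier (Mor_Hor_group n \<Xi>)"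
  then obtain w where *: "w \<in> Omega n" "\<tau> = (\<lambda>t. fscale t w)"
    by (auto simp: Mor_Hor_group_def Mor_Hor_eq)
  have "(\<lambda>t. fscale t (fscale (- 1) w)) + \<tau> = 0"
    by (simp add: * fscale_def tscale_def fun_eq_iff)
  with Omega_scale[OF *(1), of "- 1"]
  show "\<exists>\<sigma>\<in>carrier (Mor_Hor_group n \<Xi>). \<sigma> \<otimes>\<^bsub>Mor_Hor_group n \<Xi>\<^esub> \<tau> = \<one>\<^bsub>Mor_Hor_group n \<Xi>\<^esub>"
    unfolding Mor_Hor_group_def Mor_Hor_eq partial_object.simps monoid.simps by blast
qed (simp_all add: Mor_Hor_group_def add.assoc add.commute)

lemma emb_tscale: "emb (tscale c x) = fscale c (emb x)"
  by (rule ext) (simp add: emb_def fscale_def)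

lemma Upsilon_inv_unit_tens:
  assumes "v \<in> Omega n"
  shows "Upsilon_inv n \<Xi> (unit_tens n \<Xi> v) = (\<lambda>t. fscale t v)"
  unfolding Upsilon_inv_def unit_tens_def
proof (rule tens_lift_base[OF comm_group_Mor_Hor_group _ _ _ assms, where g = "\<lambda>v t. fscale t v"])
  fix x \<mu>
  show "(\<lambda>t. fmul \<Xi> (emb (tscale t x)) \<mu>) = (\<lambda>t. fscale t (fmul \<Xi> (emb x) \<mu>))"
    by (intro ext) (simp add: fmul_emb_apply fscale_def tmul_scale_left)
qed (auto simp: Mor_Hor_group_def Mor_Hor_eq fscale_add fun_eq_iff)

text \<open>
  The map \<open>T \<otimes> \<mu> \<mapsto> T \<mu>\<close> recovers \<open>v\<close> from \<open>T\<^sub>0 \<otimes> v\<close> as the value at \<open>\<vartheta>\<close>.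
\<close>

lemma unit_tens_inj:
  assumes "v \<in> Omega n" "w \<in> Omega n" "unit_tens n \<Xi> v = unit_tens n \<Xi> w"
  shows "v = w"
proof -
  have "(\<lambda>t. fscale t v) = (\<lambda>t. fscale t w)"
    using Upsilon_inv_unit_tens[OF assms(1), of \<Xi>] Upsilon_inv_unit_tens[OF assms(2), of \<Xi>] assms(3) by simp
  then have "fscale 1 v = fscale 1 w" by (rule fun_cong)
  then show ?thesis by simp
qed

text \<open>
  The map \<open>T \<otimes> \<mu> \<mapsto> T \<mu>\<close> is injective, so its chosen inverse is determined on values at unit tensors.
\<close>

lemma Upsilon_eq:
  assumes "v \<in> Omega n"
  shows "Upsilon n \<Xi> (\<lambda>t. fscale t v) = unit_tens n \<Xi> v"
proof -
  have "inj_on (Upsilon_inv n \<Xi>) (carrier (EOmega n \<Xi>))"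
    unfolding EOmega_carrier
  proof (rule inj_onI, elim imageE)
    fix C D v w
    assume *: "Upsilon_inv n \<Xi> C = Upsilon_inv n \<Xi> D" "C = unit_tens n \<Xi> v" "D = unit_tens n \<Xi> w"
      "v \<in> Omega n" "w \<in> Omega n"
    then have "(\<lambda>t. fscale t v) = (\<lambda>t. fscale t w)" by (simp add: Upsilon_inv_unit_tens)
    then have "fscale 1 v = fscale 1 w" by (rule fun_cong)
    with * show "C = D" by simp
  qed
  then show ?thesis
    unfolding Upsilon_def Upsilon_inv_unit_tens[OF assms, of \<Xi>, symmetric]
    by (rule inv_into_f_f) (rule unit_tens_closed[OF assms])
qed

section \<open>The Yang--Mills operator on base forms\<close>

text \<open>
  Left linearity over the algebra is what makes \<open>id \<otimes> F\<close> well defined.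
\<close>

lemma id_tens_unit_tens:
  assumes F: "\<And>v. v \<in> Omega n \<Longrightarrow> F v \<in> Omega n"
    and add: "\<And>v w. v \<in> Omega n \<Longrightarrow> w \<in> Omega n \<Longrightarrow> F (v + w) = F v + F w"
    and lin: "\<And>x v. x \<in> torus n \<Longrightarrow> v \<in> Omega n \<Longrightarrow> F (fmul \<Xi> (emb x) v) = fmul \<Xi> (emb x) (F v)"
    and v: "v \<in> Omega n"
  shows "id_tens n \<Xi> F (unit_tens n \<Xi> v) = unit_tens n \<Xi> (F v)"
  unfolding id_tens_def unit_tens_def[of n \<Xi> v]
  by (rule tens_lift_base[OF comm_group_EOmega _ _ _ v, where g = "\<lambda>v. unit_tens n \<Xi> (F v)"])
     (simp_all add: unit_tens_closed F add unit_tens_add tens_eq_unit_tens lin)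

lemma nabla_eq:
  assumes "\<omega> 0 = 0" "x \<in> torus n"
  shows "nabla n \<Xi> \<omega> (\<lambda>t. tscale t x) = unit_tens n \<Xi> (ext_d n \<Xi> (emb x))"
proof -
  have "(\<lambda>t. dual_D n \<Xi> \<omega> (emb (tscale t x))) = (\<lambda>t. fscale t (ext_d n \<Xi> (emb x)))"
    using assms by (intro ext[where f = "\<lambda>t. dual_D n \<Xi> \<omega> (emb (tscale t x))"])
      (simp add: dual_D_base emb_in_Omega torus_scale emb_tscale[of _ x] ext_d_scale Omega_scale)
  then show ?thesis
    unfolding nabla_def by (simp only: Upsilon_eq ext_d_in_Omega emb_in_Omega assms(2))
qed

text \<open>
  On \<open>T \<otimes> \<mu>\<close> with \<open>x = T(\<vartheta>)\<close> the twisted differential is \<open>T\<^sub>0 \<otimes> (dx \<mu> + x d\<mu>)\<close>. By the Leibniz rule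
  this is \<open>T\<^sub>0 \<otimes> d(x \<mu>)\<close>, which depends on \<open>x \<mu>\<close> only.
\<close>

lemma d_nabla_unit_tens:
  assumes "\<omega> 0 = 0" "v \<in> Omega n"
  shows "d_nabla n \<Xi> \<omega> (unit_tens n \<Xi> v) = unit_tens n \<Xi> (ext_d n \<Xi> v)"
  unfolding d_nabla_def unit_tens_def[of n \<Xi> v]
proof (rule tens_lift_base[OF comm_group_EOmega _ _ _ assms(2), where g = "\<lambda>v. unit_tens n \<Xi> (ext_d n \<Xi> v)"])
  fix x \<mu> assume x: "x \<in> torus n" and \<mu>: "\<mu> \<in> Omega n"
  have dx: "ext_d n \<Xi> (emb x) \<in> Omega n" and d\<mu>: "ext_d n \<Xi> \<mu> \<in> Omega n"
    using x \<mu> by (simp_all add: ext_d_in_Omega emb_in_Omega)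
  have "tens_rmul n \<Xi> (nabla n \<Xi> \<omega> (\<lambda>t. tscale t x)) \<mu> = unit_tens n \<Xi> (fmul \<Xi> (ext_d n \<Xi> (emb x)) \<mu>)"
    unfolding nabla_eq[where \<omega> = \<omega>, OF assms(1) x] tens_rmul_def
    by (rule id_tens_unit_tens[OF _ _ _ dx]) (simp_all add: fmul_in_Omega \<mu> fmul_add_left[where m=n] fmul_emb_assoc[where m=n])
  then show "tens_rmul n \<Xi> (nabla n \<Xi> \<omega> (\<lambda>t. tscale t x)) \<mu> \<otimes>\<^bsub>EOmega n \<Xi>\<^esub>
      tens n \<Xi> (\<lambda>t. tscale t x) (ext_d n \<Xi> \<mu>) = unit_tens n \<Xi> (ext_d n \<Xi> (fmul \<Xi> (emb x) \<mu>))"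
    using x \<mu> dx d\<mu> by (simp add: tens_eq_unit_tens ext_d_Leibniz unit_tens_add fmul_in_Omega fmul_emb_in_Omega)
qed (simp_all add: unit_tens_closed ext_d_in_Omega ext_d_add unit_tens_add)

lemma d_nabla_star_unit_tens:
  assumes "\<omega> 0 = 0" "v \<in> Omega n"
  shows "d_nabla_star n \<Xi> \<omega> a (unit_tens n \<Xi> v) =
    unit_tens n \<Xi> (hodge_inv n (ext_d n \<Xi> (hodge n v))) [^]\<^bsub>EOmega n \<Xi>\<^esub> ((-1) ^ a :: int)"
proof -
  have h: "hodge n v \<in> Omega n" by (rule hodge_in_Omega[OF assms(2)])
  have "id_tens n \<Xi> (hodge n) (unit_tens n \<Xi> v) = unit_tens n \<Xi> (hodge n v)"
    by (rule id_tens_unit_tens) (simp_all add: assms hodge_in_Omega hodge_add hodge_fmul_emb)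
  moreover have "id_tens n \<Xi> (hodge_inv n) (unit_tens n \<Xi> (ext_d n \<Xi> (hodge n v))) =
      unit_tens n \<Xi> (hodge_inv n (ext_d n \<Xi> (hodge n v)))"
    by (rule id_tens_unit_tens) (simp_all add: h ext_d_in_Omega hodge_inv_in_Omega hodge_inv_add hodge_inv_fmul_emb)
  ultimately show ?thesis
    unfolding d_nabla_star_def by (simp only: d_nabla_unit_tens[where \<omega> = \<omega>, OF assms(1) h])
qed

text \<open>
  The canonical connection is a constant multiple of \<open>d\<bbbU>\<^sub>n\<^sub>+\<^sub>1\<close>, so it is closed and the curvature
  comes from the displacement \<open>lam\<close> alone.
\<close>

lemma ext_d_omega_c: "ext_d (Suc n) \<Xi> (omega_c n \<Xi> t) = 0"
proof -
  have "ext_d (Suc n) \<Xi> (dU {Suc n}) = 0"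
  proof
    fix K
    have "delta j (dU {Suc n} I) = 0" for j I by (simp add: dU_def)
    then show "ext_d (Suc n) \<Xi> (dU {Suc n}) K = 0 K"
      by (simp add: ext_d_apply)
  qed
  then show ?thesis
    unfolding omega_c_def by (simp add: gen_star_d_gen ext_d_scale)
qed

lemma curvature_eq:
  assumes "Vector_Spaces.linear (*) fscale lam" "lam theta \<in> Omega n"
  shows "curvature n \<Xi> (omega_c n \<Xi> + lam) = (\<lambda>t. fscale t (ext_d n \<Xi> (lam theta)))"
proof -
  obtain \<mu> where lam: "lam = (\<lambda>t. fscale t \<mu>)" using assms(1) linear_fscale_iff by blast
  have \<mu>: "lam theta = \<mu>" by (simp add: lam theta_def)
  show ?thesis
    using assms(2) unfolding curvature_def \<mu>
    by (simp add: lam ext_d_add ext_d_omega_c ext_d_scale ext_d_Suc_base)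
qed

theorem theorem6p6:
  fixes n :: nat and \<Xi> :: "nat \<Rightarrow> nat \<Rightarrow> real"
    and \<omega> lam :: "u1 \<Rightarrow> form" and \<mu> :: form
  assumes "n \<ge> 2"
    and "\<And>i j. i \<in> {1..Suc n} \<Longrightarrow> j \<in> {1..Suc n} \<Longrightarrow> \<Xi> i j = - \<Xi> j i"
    and "is_qpc n \<Xi> \<omega>"
    and "\<omega> \<noteq> omega_c n \<Xi>"
    and "Vector_Spaces.linear (*) fscale lam"
    and "\<omega> = omega_c n \<Xi> + lam"
    and "lam theta = \<mu>"
    and "\<mu> \<in> Omega_deg 1 n"
    and "fstar \<Xi> \<mu> = \<mu>"
  shows "yang_mills n \<Xi> \<omega> \<longleftrightarrow> d_star n \<Xi> 1 (ext_d n \<Xi> \<mu>) = 0"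
proof -
  interpret group "EOmega n \<Xi>" by (rule group_EOmega)
  have \<mu>: "\<mu> \<in> Omega n" using assms(8) by (simp add: Omega_deg_def)
  then have d\<mu>: "ext_d n \<Xi> \<mu> \<in> Omega n" by (rule ext_d_in_Omega)
  define v where "v = hodge_inv n (ext_d n \<Xi> (hodge n (ext_d n \<Xi> \<mu>)))"
  have v: "v \<in> Omega n"
    unfolding v_def by (intro hodge_inv_in_Omega ext_d_in_Omega hodge_in_Omega d\<mu>)
  obtain \<nu> where "\<omega> = (\<lambda>t. fscale t \<nu>)"
    using assms(3) linear_fscale_iff unfolding is_qpc_def by blast
  then have \<omega>0: "\<omega> 0 = 0" by simp
  have "curvature n \<Xi> \<omega> = (\<lambda>t. fscale t (ext_d n \<Xi> \<mu>))"
    using curvature_eq[OF assms(5)] \<mu> unfolding assms(6,7) by blast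
  then have "d_nabla_star n \<Xi> \<omega> 1 (Upsilon n \<Xi> (curvature n \<Xi> \<omega>)) = inv\<^bsub>EOmega n \<Xi>\<^esub> unit_tens n \<Xi> v"
    by (simp add: Upsilon_eq[OF d\<mu>] d_nabla_star_unit_tens[where \<omega> = \<omega>, OF \<omega>0 d\<mu>] v_def[symmetric]
        int_pow_neg unit_tens_closed[OF v])
  \<comment> \<open>The sign \<open>(-1)\<^sup>1\<close> is inversion in the tensor product, and an inverse is trivial only if the
    element is.\<close>
  then have "yang_mills n \<Xi> \<omega> \<longleftrightarrow> unit_tens n \<Xi> v = unit_tens n \<Xi> 0"
    using assms(3) unit_tens_closed[OF v, of \<Xi>] by (simp add: yang_mills_def unit_tens_zero inv_eq_1_iff)
  also have "\<dots> \<longleftrightarrow> v = 0" using unit_tens_inj[OF v Omega_zero] by blast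
  also have "\<dots> \<longleftrightarrow> d_star n \<Xi> 1 (ext_d n \<Xi> \<mu>) = 0"
  proof -
    have "d_star n \<Xi> 1 (ext_d n \<Xi> \<mu>) = fscale (- 1) v" by (simp add: d_star_def v_def)
    moreover have "v = fscale (- 1) (fscale (- 1) v)" by simp
    ultimately show ?thesis by (metis fscale_zero)
  qed
  finally show ?thesis .
qed

end
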